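(* Let $n$ be a positive integer, $\mathbf{u}=(u_0,\dots,u_n)$ with $u_k\in H(\mathbb{D})$, and $\varphi$ an analytic self-map of $\mathbb{D}$. Then $L_{\mathbf{u},\varphi}^{(n)}:A^2\to A^2$ is Hilbert–Schmidt if and only if each $W_{u_k,\varphi}^{(k)}:A^2\to A^2$, $k=0,1,\dots,n$, is Hilbert–Schmidt.
   Context: $\mathbb{D}$ is the open unit disc, $H(\mathbb{D})$ the analytic functions on $\mathbb{D}$, $dA=\frac{dx\,dy}{\pi}$, and $A^2=\{f\in H(\mathbb{D}):\int_{\mathbb{D}}|f|^2\,dA<\infty\}$ with inner product $\langle f,g\rangle=\int_{\mathbb{D}}f\bar g\,dA$. For $u\in H(\mathbb{D})$ and integer $k\ge0$, $W_{u,\varphi}^{(k)}f=u\cdot(f^{(k)}\circ\varphi)$, and $L_{\mathbf{u},\varphi}^{(n)}=\sum_{k=0}^nW_{u_k,\varphi}^{(k)}$. *)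

theory Defs
  imports "HOL-Complex_Analysis.Complex_Analysis"
begin

text \<open>The Bergman space A^2 on the unit disc, with normalised area measure dA = dx dy / pi.
  Functions are represented as complex => complex; only values on the disc matter.\<close>

definition A2 :: "(complex \<Rightarrow> complex) set" where
  "A2 = {f. f holomorphic_on ball 0 1 \<and>
            set_integrable lborel (ball 0 1) (\<lambda>z. (cmod (f z))\<^sup>2)}"

definition A2_inner :: "(complex \<Rightarrow> complex) \<Rightarrow> (complex \<Rightarrow> complex) \<Rightarrow> complex" where
  "A2_inner f g = complex_of_real (1 / pi) * (LINT z:ball 0 1|lborel. f z * cnj (g z))"

definition A2_norm :: "(complex \<Rightarrow> complex) \<Rightarrow> real" where
  "A2_norm f = sqrt ((1 / pi) * (LINT z:ball 0 1|lborel. (cmod (f z))\<^sup>2))"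

definition A2_orthonormal_basis :: "(nat \<Rightarrow> complex \<Rightarrow> complex) \<Rightarrow> bool" where
  "A2_orthonormal_basis e \<longleftrightarrow>
     (\<forall>j. e j \<in> A2) \<and>
     (\<forall>i j. A2_inner (e i) (e j) = (if i = j then 1 else 0)) \<and>
     (\<forall>f\<in>A2. (\<forall>j. A2_inner f (e j) = 0) \<longrightarrow> A2_norm f = 0)"

text \<open>A bounded operator T : A^2 -> A^2 is Hilbert--Schmidt if sum ||T e_j||^2 < infinity
  for an orthonormal basis (e_j) of A^2 (this is independent of the basis).\<close>
definition hilbert_schmidt_A2 :: "((complex \<Rightarrow> complex) \<Rightarrow> (complex \<Rightarrow> complex)) \<Rightarrow> bool" where
  "hilbert_schmidt_A2 T \<longleftrightarrow>
     (\<forall>f\<in>A2. T f \<in> A2) \<and>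
     (\<exists>C. \<forall>f\<in>A2. A2_norm (T f) \<le> C * A2_norm f) \<and>
     (\<exists>e. A2_orthonormal_basis e \<and> summable (\<lambda>j. (A2_norm (T (e j)))\<^sup>2))"

definition W_op :: "(complex \<Rightarrow> complex) \<Rightarrow> (complex \<Rightarrow> complex) \<Rightarrow> nat
                    \<Rightarrow> (complex \<Rightarrow> complex) \<Rightarrow> (complex \<Rightarrow> complex)" where
  "W_op u \<phi> k f = (\<lambda>z. u z * (deriv ^^ k) f (\<phi> z))"

definition L_op :: "(nat \<Rightarrow> complex \<Rightarrow> complex) \<Rightarrow> (complex \<Rightarrow> complex) \<Rightarrow> nat
                    \<Rightarrow> (complex \<Rightarrow> complex) \<Rightarrow> (complex \<Rightarrow> complex)" where
  "L_op u \<phi> n f = (\<lambda>z. \<Sum>k\<le>n. W_op (u k) \<phi> k f z)"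

end

theory Submission
  imports Defs
begin

text \<open>Both sides are equivalent to the integrability of
  \<open>\<bar>u k\<bar>\<^sup>2 / (1 - \<bar>\<phi>\<bar>)\<^sup>2\<^sup>(\<^sup>k\<^sup>+\<^sup>1\<^sup>)\<close> over the disc for all \<open>k \<le> n\<close>. For an orthonormal basis
  \<open>e\<close>, the sum \<open>\<Sum>j. \<parallel>L (e j)\<parallel>\<^sup>2\<close> is the integral over \<open>z\<close> of the squared norm of the functional
  \<open>f \<mapsto> \<Sum>k. u k z f\<^sup>(\<^sup>k\<^sup>)(\<phi> z)\<close> on \<open>A2\<close>. The norm of \<open>f \<mapsto> \<Sum>k. a k f\<^sup>(\<^sup>k\<^sup>)(w)\<close> is comparable to
  \<open>\<Sum>k. \<bar>a k\<bar> / (1 - \<bar>w\<bar>)\<^sup>k\<^sup>+\<^sup>1\<close>, uniformly in \<open>w\<close>: Cauchy estimates give the upper bound, and test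
  functions vanishing to order \<open>k\<close> at \<open>w\<close> show that there is no cancellation between the terms.\<close>

section \<open>The Bergman space\<close>

abbreviation disc_measure :: "complex measure" where
  "disc_measure \<equiv> restrict_space lborel (ball 0 1)"

lemma finite_measure_disc: "finite_measure disc_measure"
  by (rule finite_measureI)
     (use emeasure_lborel_ball_finite[of "0::complex" 1]
       in \<open>auto simp: space_restrict_space emeasure_restrict_space less_top\<close>)

lemma continuous_on_disc_measurable:
  "continuous_on (ball 0 1) f \<Longrightarrow> f \<in> borel_measurable disc_measure"
  for f :: "complex \<Rightarrow> 'b::topological_space"
  using borel_measurable_continuous_on_restrict[of "ball 0 1" f]
  by (simp add: measurable_def sets_restrict_space space_restrict_space)

lemma holomorphic_disc_measurable:
  "f holomorphic_on ball 0 1 \<Longrightarrow> f \<in> borel_measurable disc_measure"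
  by (simp add: continuous_on_disc_measurable holomorphic_on_imp_continuous_on)

lemma A2_iff:
  "f \<in> A2 \<longleftrightarrow> f holomorphic_on ball 0 1 \<and> integrable disc_measure (\<lambda>z. (cmod (f z))\<^sup>2)"
  by (simp add: A2_def set_integrable_def integrable_restrict_space)

lemma A2_holomorphic: "f \<in> A2 \<Longrightarrow> f holomorphic_on ball 0 1"
  by (simp add: A2_iff)

lemma A2_integrable: "f \<in> A2 \<Longrightarrow> integrable disc_measure (\<lambda>z. (cmod (f z))\<^sup>2)"
  by (simp add: A2_iff)

lemma A2_measurable: "f \<in> A2 \<Longrightarrow> f \<in> borel_measurable disc_measure"
  by (simp add: A2_iff holomorphic_disc_measurable)

lemma A2_inner_disc:
  "A2_inner f g = complex_of_real (1 / pi) * (LINT z|disc_measure. f z * cnj (g z))"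
  by (simp add: A2_inner_def set_lebesgue_integral_def integral_restrict_space)

lemma A2_norm_sq: "(A2_norm f)\<^sup>2 = (1 / pi) * (LINT z|disc_measure. (cmod (f z))\<^sup>2)"
  by (simp add: A2_norm_def set_lebesgue_integral_def integral_restrict_space)

lemma A2_norm_nonneg [simp]: "A2_norm f \<ge> 0"
  by (simp add: A2_norm_def set_lebesgue_integral_def)

lemma A2_memI_bound:
  assumes "f holomorphic_on ball 0 1" "integrable disc_measure g"
    and "\<And>z. z \<in> ball 0 1 \<Longrightarrow> (cmod (f z))\<^sup>2 \<le> g z"
  shows "f \<in> A2"
proof -
  have "integrable disc_measure (\<lambda>z. (cmod (f z))\<^sup>2)"
    by (rule Bochner_Integration.integrable_bound[OF assms(2)])
       (use holomorphic_disc_measurable[OF assms(1)] assms(3) in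
         \<open>auto simp: space_restrict_space intro!: AE_I2 order_trans[OF _ abs_ge_self]\<close>)
  with assms(1) show ?thesis by (simp add: A2_iff)
qed

lemma A2_norm_sq_le:
  assumes "f \<in> A2" "integrable disc_measure g"
    and "\<And>z. z \<in> ball 0 1 \<Longrightarrow> (cmod (f z))\<^sup>2 \<le> g z"
  shows "(A2_norm f)\<^sup>2 \<le> (1 / pi) * (LINT z|disc_measure. g z)"
  unfolding A2_norm_sq using assms
  by (intro mult_left_mono integral_mono) (auto simp: A2_integrable space_restrict_space)

lemma A2_norm_cong: "(\<And>z. z \<in> ball 0 1 \<Longrightarrow> cmod (f z) = cmod (g z)) \<Longrightarrow> A2_norm f = A2_norm g"
  unfolding A2_norm_def by (auto intro!: arg_cong[where f=sqrt] set_lebesgue_integral_cong)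

lemma A2_norm_sq_nn_integral:
  assumes "f \<in> A2"
  shows "(\<integral>\<^sup>+z. ennreal ((cmod (f z))\<^sup>2) \<partial>disc_measure) = ennreal (pi * (A2_norm f)\<^sup>2)"
  using nn_integral_eq_integral[OF A2_integrable[OF assms]] by (simp add: A2_norm_sq)

lemma A2_memI_nn_integral:
  assumes "f holomorphic_on ball 0 1"
    and "(\<integral>\<^sup>+z. ennreal ((cmod (f z))\<^sup>2) \<partial>disc_measure) \<le> ennreal (pi * C)" "C \<ge> 0"
  shows "f \<in> A2" "(A2_norm f)\<^sup>2 \<le> C"
proof -
  show f: "f \<in> A2"
    unfolding A2_iff using assms holomorphic_disc_measurable[OF assms(1)]
    by (auto intro!: integrableI_bounded order.strict_trans1[OF assms(2)])
  show "(A2_norm f)\<^sup>2 \<le> C"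
    using assms(2,3) unfolding A2_norm_sq_nn_integral[OF f] by simp
qed

lemma A2_zero: "(\<lambda>z. 0) \<in> A2"
  by (simp add: A2_iff)

lemma A2_cmult: "f \<in> A2 \<Longrightarrow> (\<lambda>z. c * f z) \<in> A2"
  by (auto simp: A2_iff norm_mult power_mult_distrib intro!: holomorphic_intros)

lemma A2_add:
  assumes "f \<in> A2" "g \<in> A2"
  shows "(\<lambda>z. f z + g z) \<in> A2"
proof (rule A2_memI_bound)
  show "integrable disc_measure (\<lambda>z. 2 * (cmod (f z))\<^sup>2 + 2 * (cmod (g z))\<^sup>2)"
    using assms by (auto simp: A2_iff)
  show "(cmod (f z + g z))\<^sup>2 \<le> 2 * (cmod (f z))\<^sup>2 + 2 * (cmod (g z))\<^sup>2" for z
  proof -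
    have "(cmod (f z + g z))\<^sup>2 \<le> (cmod (f z) + cmod (g z))\<^sup>2"
      by (intro power_mono norm_triangle_ineq) auto
    with sum_squares_bound[of "cmod (f z)" "cmod (g z)"] show ?thesis
      by (simp add: power2_sum)
  qed
qed (use assms in \<open>auto simp: A2_iff intro!: holomorphic_intros\<close>)

lemma A2_diff: "f \<in> A2 \<Longrightarrow> g \<in> A2 \<Longrightarrow> (\<lambda>z. f z - g z) \<in> A2"
  using A2_add[of f "\<lambda>z. (-1) * g z"] A2_cmult[of g "-1"] by simp

lemma A2_sum: "(\<And>i. i \<in> I \<Longrightarrow> f i \<in> A2) \<Longrightarrow> (\<lambda>z. \<Sum>i\<in>I. f i z) \<in> A2"
  by (induction I rule: infinite_finite_induct) (auto simp: A2_zero A2_add)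

section \<open>The inner product: sesquilinearity and its relation to the norm\<close>

lemma A2_inner_integrable:
  assumes "f \<in> A2" "g \<in> A2"
  shows "integrable disc_measure (\<lambda>z. f z * cnj (g z))"
proof (rule Bochner_Integration.integrable_bound)
  show "integrable disc_measure (\<lambda>z. (cmod (f z))\<^sup>2 + (cmod (g z))\<^sup>2)"
    using assms by (auto simp: A2_iff)
  show "(\<lambda>z. f z * cnj (g z)) \<in> borel_measurable disc_measure"
    using assms by (intro continuous_on_disc_measurable continuous_intros
        holomorphic_on_imp_continuous_on A2_holomorphic)
  have "cmod (f z) * cmod (g z) \<le> (cmod (f z))\<^sup>2 + (cmod (g z))\<^sup>2" for z
    using sum_squares_bound[of "cmod (f z)" "cmod (g z)"]
      mult_nonneg_nonneg[OF norm_ge_zero[of "f z"] norm_ge_zero[of "g z"]] by linarith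
  then show "AE z in disc_measure. norm (f z * cnj (g z)) \<le> norm ((cmod (f z))\<^sup>2 + (cmod (g z))\<^sup>2)"
    by (simp add: norm_mult)
qed

lemma A2_inner_add_left:
  "f \<in> A2 \<Longrightarrow> g \<in> A2 \<Longrightarrow> h \<in> A2 \<Longrightarrow> A2_inner (\<lambda>z. f z + g z) h = A2_inner f h + A2_inner g h"
  unfolding A2_inner_disc
  by (simp add: ring_distribs Bochner_Integration.integral_add A2_inner_integrable)

lemma A2_inner_cmult_left: "A2_inner (\<lambda>z. c * f z) h = c * A2_inner f h"
  unfolding A2_inner_disc by (simp add: mult.assoc)

lemma A2_inner_diff_left:
  "f \<in> A2 \<Longrightarrow> g \<in> A2 \<Longrightarrow> h \<in> A2 \<Longrightarrow> A2_inner (\<lambda>z. f z - g z) h = A2_inner f h - A2_inner g h"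
  unfolding A2_inner_disc
  by (simp add: ring_distribs Bochner_Integration.integral_diff A2_inner_integrable)

lemma A2_inner_cnj: "A2_inner g f = cnj (A2_inner f g)"
  unfolding A2_inner_disc by (simp add: mult.commute flip: Bochner_Integration.integral_cnj)

lemma A2_inner_zero_left: "A2_inner (\<lambda>z. 0) h = 0"
  unfolding A2_inner_disc by simp

lemma A2_inner_sum_left:
  "(\<And>i. i \<in> I \<Longrightarrow> f i \<in> A2) \<Longrightarrow> h \<in> A2 \<Longrightarrow> A2_inner (\<lambda>z. \<Sum>i\<in>I. f i z) h = (\<Sum>i\<in>I. A2_inner (f i) h)"
  by (induction I rule: infinite_finite_induct)
     (auto simp: A2_inner_zero_left A2_inner_add_left A2_sum)

lemma A2_inner_self: "A2_inner f f = complex_of_real ((A2_norm f)\<^sup>2)"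
proof -
  have "f z * cnj (f z) = complex_of_real ((cmod (f z))\<^sup>2)" for z
    by (simp only: complex_norm_square)
  then show ?thesis unfolding A2_inner_disc A2_norm_sq
    by (simp del: of_real_power)
qed

lemma A2_norm_sq_diff:
  assumes "f \<in> A2" "g \<in> A2"
  shows "(A2_norm (\<lambda>z. f z - g z))\<^sup>2 = (A2_norm f)\<^sup>2 - 2 * Re (A2_inner f g) + (A2_norm g)\<^sup>2"
proof -
  let ?d = "\<lambda>z. f z - g z"
  have d: "?d \<in> A2" using assms by (rule A2_diff)
  have "A2_inner ?d ?d = A2_inner f ?d - A2_inner g ?d"
    using assms d by (rule A2_inner_diff_left)
  also have "\<dots> = cnj (A2_inner ?d f) - cnj (A2_inner ?d g)"
    by (metis A2_inner_cnj)
  also have "\<dots> = cnj (A2_inner f f) - cnj (A2_inner g f) - (cnj (A2_inner f g) - cnj (A2_inner g g))"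
    using assms by (simp add: A2_inner_diff_left)
  finally have "Re (A2_inner ?d ?d) = Re \<dots>" by simp
  then show ?thesis
    unfolding A2_inner_self A2_inner_cnj[of g f] by (simp del: of_real_power)
qed

section \<open>Orthonormal systems\<close>

text \<open>The part of \<open>A2_orthonormal_basis\<close> without completeness, kept separate
  because Bessel's inequality and the bound on sums over finitely many basis elements rest on this
  part alone.\<close>

definition A2_orthonormal :: "(nat \<Rightarrow> complex \<Rightarrow> complex) \<Rightarrow> bool" where
  "A2_orthonormal e \<longleftrightarrow>
     (\<forall>j. e j \<in> A2) \<and> (\<forall>i j. A2_inner (e i) (e j) = (if i = j then 1 else 0))"

lemma A2_lincomb_mem: "A2_orthonormal e \<Longrightarrow> (\<lambda>z. \<Sum>j\<in>I. a j * e j z) \<in> A2"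
  unfolding A2_orthonormal_def by (intro A2_sum A2_cmult) auto

lemma A2_inner_lincomb:
  assumes "A2_orthonormal e" "finite I"
  shows "A2_inner (\<lambda>z. \<Sum>j\<in>I. a j * e j z) (e i) = (if i \<in> I then a i else 0)"
proof -
  have "A2_inner (\<lambda>z. \<Sum>j\<in>I. a j * e j z) (e i) = (\<Sum>j\<in>I. a j * A2_inner (e j) (e i))"
    using assms by (subst A2_inner_sum_left) (auto simp: A2_orthonormal_def A2_cmult A2_inner_cmult_left)
  also have "\<dots> = (\<Sum>j\<in>I. if j = i then a i else 0)"
    using assms by (intro sum.cong) (auto simp: A2_orthonormal_def)
  finally show ?thesis using assms by simp
qed

lemma A2_inner_lincomb_right:
  assumes "A2_orthonormal e" "f \<in> A2"
  shows "A2_inner f (\<lambda>z. \<Sum>j\<in>I. a j * e j z) = (\<Sum>j\<in>I. cnj (a j) * A2_inner f (e j))"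
proof -
  have "A2_inner (\<lambda>z. \<Sum>j\<in>I. a j * e j z) f = (\<Sum>j\<in>I. a j * A2_inner (e j) f)"
    using assms by (subst A2_inner_sum_left) (auto simp: A2_orthonormal_def A2_cmult A2_inner_cmult_left)
  then show ?thesis
    by (subst A2_inner_cnj) (simp flip: A2_inner_cnj)
qed

lemma A2_norm_lincomb:
  assumes "A2_orthonormal e" "finite I"
  shows "(A2_norm (\<lambda>z. \<Sum>j\<in>I. a j * e j z))\<^sup>2 = (\<Sum>j\<in>I. (cmod (a j))\<^sup>2)"
proof -
  let ?f = "\<lambda>z. \<Sum>j\<in>I. a j * e j z"
  have "complex_of_real ((A2_norm ?f)\<^sup>2) = (\<Sum>j\<in>I. cnj (a j) * A2_inner ?f (e j))"
    using assms by (subst A2_inner_self[symmetric], subst A2_inner_lincomb_right)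
      (auto simp: A2_lincomb_mem)
  also have "\<dots> = (\<Sum>j\<in>I. complex_of_real ((cmod (a j))\<^sup>2))"
    unfolding complex_norm_square using assms
    by (intro sum.cong) (auto simp: A2_inner_lincomb mult.commute)
  finally show ?thesis by (simp only: of_real_eq_iff flip: of_real_sum)
qed

text \<open>The inner product of \<open>f\<close> with its orthogonal projection onto the span of
  the \<open>e j\<close> equals the squared norm of that projection. Expanding the norm of the
  difference then gives Pythagoras.\<close>

lemma A2_Bessel_eq:
  assumes "A2_orthonormal e" "finite I" "f \<in> A2"
  shows "(A2_norm (\<lambda>z. f z - (\<Sum>j\<in>I. A2_inner f (e j) * e j z)))\<^sup>2 =
           (A2_norm f)\<^sup>2 - (\<Sum>j\<in>I. (cmod (A2_inner f (e j)))\<^sup>2)"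
proof -
  let ?s = "\<lambda>z. \<Sum>j\<in>I. A2_inner f (e j) * e j z"
  have "A2_inner f ?s = (\<Sum>j\<in>I. complex_of_real ((cmod (A2_inner f (e j)))\<^sup>2))"
    unfolding A2_inner_lincomb_right[OF assms(1,3)] complex_norm_square by (simp add: mult.commute)
  then have "Re (A2_inner f ?s) = (\<Sum>j\<in>I. (cmod (A2_inner f (e j)))\<^sup>2)"
    by (simp flip: of_real_sum del: of_real_power)
  then show ?thesis
    using assms by (subst A2_norm_sq_diff) (auto simp: A2_lincomb_mem A2_norm_lincomb)
qed

lemma A2_Bessel:
  assumes "A2_orthonormal e" "finite I" "f \<in> A2"
  shows "(\<Sum>j\<in>I. (cmod (A2_inner f (e j)))\<^sup>2) \<le> (A2_norm f)\<^sup>2"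
  using A2_Bessel_eq[OF assms] zero_le_power2[of "A2_norm (\<lambda>z. f z - (\<Sum>j\<in>I. A2_inner f (e j) * e j z))"]
  by linarith

text \<open>Bessel's inequality for one element: the Cauchy-Schwarz inequality against a unit
  vector.\<close>

lemma A2_inner_le_norm:
  assumes "A2_orthonormal e" "f \<in> A2"
  shows "cmod (A2_inner f (e j)) \<le> A2_norm f"
  using A2_Bessel[OF assms(1) _ assms(2), of "{j}"] by (simp add: power2_le_iff_abs_le)

section \<open>Point evaluations\<close>

lemma measure_disc_ball:
  assumes "ball z r \<subseteq> ball (0::complex) 1" "r \<ge> 0"
  shows "measure disc_measure (ball z r) = pi * r\<^sup>2"
proof -
  have "measure disc_measure (ball z r) = measure lborel (ball z r)"
    using assms by (intro measure_restrict_space) auto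
  also have "\<dots> = pi * r\<^sup>2"
    using assms content_ball[of r z] by (simp add: unit_ball_vol_2)
  finally show ?thesis .
qed

text \<open>Integrating \<open>m\<^sup>2\<close> over the small ball gives
  \<open>m\<^sup>2 * pi * r\<^sup>2\<close>, and the normalisation of the area measure cancels
  \<open>pi\<close>. This turns a lower bound for \<open>cmod (f z)\<close> on a ball into one for
  the norm.\<close>

lemma A2_norm_ge_on_ball:
  assumes "f \<in> A2" "ball w r \<subseteq> ball 0 1" "r \<ge> 0" "m \<ge> 0"
    and m: "\<And>z. z \<in> ball w r \<Longrightarrow> m \<le> cmod (f z)"
  shows "m * r \<le> A2_norm f"
proof -
  interpret finite_measure disc_measure by (rule finite_measure_disc)
  have sets: "ball w r \<in> sets disc_measure"
    using assms(2) by (auto simp: sets_restrict_space_iff)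
  have "(LINT z|disc_measure. m\<^sup>2 * indicat_real (ball w r) z)
      \<le> (LINT z|disc_measure. (cmod (f z))\<^sup>2)"
  proof (rule integral_mono)
    show "integrable disc_measure (\<lambda>z. m\<^sup>2 * indicat_real (ball w r) z)"
      using sets by (intro integrable_mult_right integrable_real_indicator) (auto simp: emeasure_eq_measure)
    show "m\<^sup>2 * indicat_real (ball w r) z \<le> (cmod (f z))\<^sup>2" for z
      using m[of z] \<open>m \<ge> 0\<close> by (auto simp: indicator_def intro: power_mono)
  qed (use assms in \<open>simp add: A2_integrable\<close>)
  then have "m\<^sup>2 * (pi * r\<^sup>2) \<le> pi * (A2_norm f)\<^sup>2"
    using sets assms by (simp add: A2_norm_sq measure_disc_ball space_restrict_space Int_absorb2)
  then have "(m * r)\<^sup>2 \<le> (A2_norm f)\<^sup>2"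
    by (simp add: power_mult_distrib mult.left_commute)
  then show ?thesis by (rule power2_le_imp_le) simp
qed

text \<open>No mean value formula is needed: at a maximum point \<open>z0\<close> of
  \<open>\<bar>f z\<bar> (\<rho> - \<bar>z\<bar>)\<close> the Cauchy estimate keeps \<open>\<bar>f\<bar>\<close> above \<open>\<bar>f z0\<bar> / 2\<close> on a ball whose radius is
  comparable to \<open>\<rho> - \<bar>z0\<bar>\<close>.\<close>
lemma A2_point_evaluation_aux:
  assumes f: "f \<in> A2" and \<rho>: "\<rho> < 1" and z: "cmod z \<le> \<rho>"
  shows "cmod (f z) * (\<rho> - cmod z) \<le> 32 * A2_norm f"
proof -
  have hol: "f holomorphic_on ball 0 1" using f by (rule A2_holomorphic)
  have cont: "continuous_on (cball 0 \<rho>) f"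
    using hol \<rho> by (intro holomorphic_on_imp_continuous_on holomorphic_on_subset[OF hol]) auto
  have "compact (cball (0::complex) \<rho>)" "cball (0::complex) \<rho> \<noteq> {}"
    using z norm_ge_zero[of z] by (auto simp del: norm_ge_zero)
  moreover have "continuous_on (cball 0 \<rho>) (\<lambda>z. cmod (f z) * (\<rho> - cmod z))"
    by (intro continuous_intros cont)
  ultimately obtain z0 where z0: "z0 \<in> cball 0 \<rho>"
    and max: "\<And>y. y \<in> cball 0 \<rho> \<Longrightarrow> cmod (f y) * (\<rho> - cmod y) \<le> cmod (f z0) * (\<rho> - cmod z0)"
    by (meson continuous_attains_sup)
  define d where "d = \<rho> - cmod z0"
  define A where "A = cmod (f z0)"
  have "A * d \<le> 32 * A2_norm f"
  proof (cases "d > 0")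
    case False
    then have "d = 0" using z0 by (simp add: d_def)
    then show ?thesis by simp
  next
    case d: True
    \<comment> \<open>Within distance \<open>d / 2\<close> of \<open>z0\<close> the factor
      \<open>\<rho> - cmod y\<close> drops to no less than \<open>d / 2\<close>, so maximality at
      \<open>z0\<close> allows \<open>f\<close> to grow at most by a factor 2.\<close>
    have bound: "cmod (f y) \<le> 2 * A" if "dist z0 y \<le> d / 2" for y
    proof -
      have "cmod y \<le> cmod z0 + d / 2"
        using that norm_triangle_ineq2[of y z0] by (simp add: dist_norm norm_minus_commute)
      then have y: "d / 2 \<le> \<rho> - cmod y" by (simp add: d_def field_simps)
      then have "cmod (f y) * (d / 2) \<le> cmod (f y) * (\<rho> - cmod y)"
        by (intro mult_left_mono) auto
      also have "\<dots> \<le> A * d"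
        using max[of y] y d by (simp add: A_def d_def)
      finally show ?thesis using d by (simp add: field_simps)
    qed
    have sub: "dist z0 y \<le> d / 2 \<Longrightarrow> y \<in> ball 0 1" for y
      using norm_triangle_ineq2[of y z0] \<rho> d by (simp add: dist_norm norm_minus_commute d_def)
    \<comment> \<open>Circles of radius \<open>d / 4\<close> around such \<open>y\<close> stay in
      the region of the previous bound, and \<open>2 * A\<close> divided by \<open>d / 4\<close> is
      \<open>8 * A / d\<close>.\<close>
    have deriv: "cmod (deriv f y) \<le> 8 * A / d" if "dist z0 y \<le> d / 4" for y
    proof -
      have in2: "dist z0 x \<le> d / 2" if "dist y x \<le> d / 4" for x
        using that \<open>dist z0 y \<le> d / 4\<close> dist_triangle[of z0 x y] by linarith
      have "cball y (d/4) \<subseteq> ball 0 1"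
        by (rule subsetI, rule sub, rule in2) simp
      then have h: "f holomorphic_on cball y (d/4)" by (rule holomorphic_on_subset[OF hol])
      have "norm ((deriv ^^ 1) f y) \<le> fact 1 * (2 * A) / (d / 4) ^ 1"
      proof (rule Cauchy_inequality)
        show "f holomorphic_on ball y (d/4)" using h by (rule holomorphic_on_subset) auto
        show "continuous_on (cball y (d/4)) f" using h by (rule holomorphic_on_imp_continuous_on)
        show "norm (f x) \<le> 2 * A" if "norm (y - x) = d / 4" for x
          using bound in2 that by (simp add: dist_norm)
      qed (use d in auto)
      then show ?thesis using d by (simp add: field_simps)
    qed
    \<comment> \<open>The radius \<open>d / 16\<close> is chosen so that the derivative bound
      \<open>8 * A / d\<close> lets \<open>f\<close> vary by at most \<open>A / 2\<close>.\<close>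
    have lower: "A / 2 \<le> cmod (f y)" if "y \<in> ball z0 (d / 16)" for y
    proof -
      have "norm (f z0 - f y) \<le> 8 * A / d * norm (z0 - y)"
      proof (rule field_differentiable_bound)
        show "(f has_field_derivative deriv f x) (at x within cball z0 (d/4))" if "x \<in> cball z0 (d/4)" for x
          using that sub[of x] d hol by (intro DERIV_subset[OF holomorphic_derivI]) auto
        show "norm (deriv f x) \<le> 8 * A / d" if "x \<in> cball z0 (d/4)" for x
          using deriv[of x] that by simp
      qed (use that d in auto)
      also have "\<dots> \<le> 8 * A / d * (d / 16)"
        using that d by (intro mult_left_mono) (auto simp: dist_norm A_def)
      finally have "norm (f z0 - f y) \<le> A / 2" using d by simp
      then show ?thesis using norm_triangle_ineq2[of "f z0" "f y"] by (simp add: A_def)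
    qed
    have "ball z0 (d/16) \<subseteq> ball 0 1"
      by (rule subsetI, rule sub) (use d in auto)
    \<comment> \<open>The constant 32 of the statement is the product of 2 and 16.\<close>
    then have "A / 2 * (d / 16) \<le> A2_norm f"
      using f d lower by (intro A2_norm_ge_on_ball) (auto simp: A_def)
    then show ?thesis by simp
  qed
  then show ?thesis using max[of z] z by (simp add: A_def d_def)
qed

text \<open>The auxiliary estimate has a constant independent of \<open>\<rho>\<close>, so
  \<open>\<rho>\<close> may tend to 1 from the left.\<close>

lemma A2_point_evaluation:
  assumes f: "f \<in> A2" and z: "cmod z < 1"
  shows "cmod (f z) * (1 - cmod z) \<le> 32 * A2_norm f"
proof (rule tendsto_upperbound)
  show "((\<lambda>\<rho>. cmod (f z) * (\<rho> - cmod z)) \<longlongrightarrow> cmod (f z) * (1 - cmod z)) (at_left 1)"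
    by (intro tendsto_intros)
  show "\<forall>\<^sub>F \<rho> in at_left 1. cmod (f z) * (\<rho> - cmod z) \<le> 32 * A2_norm f"
    using eventually_at_left_real[OF z] by eventually_elim (use A2_point_evaluation_aux[OF f] in auto)
qed auto

text \<open>Completeness of a basis is phrased through vanishing norm; this converts it to equality
  at each point of the disc.\<close>

lemma A2_norm_zero_imp:
  assumes "f \<in> A2" "A2_norm f = 0" "cmod z < 1"
  shows "f z = 0"
  using A2_point_evaluation[of f z] assms by (simp add: mult_le_0_iff)

definition deriv_const :: "nat \<Rightarrow> real" where
  "deriv_const k = 64 * 2 ^ k * fact k"

lemma deriv_const_pos: "deriv_const k > 0"
  by (simp add: deriv_const_def)

text \<open>Cauchy's inequality on the circle around \<open>w\<close> whose radius is half the
  distance \<open>d\<close> to the unit circle. Its points keep distance at least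
  \<open>d / 2\<close> from the boundary, so point evaluation bounds \<open>f\<close> there by
  \<open>64 * A2_norm f / d\<close>; this is the origin of the factors in
  \<open>deriv_const\<close>.\<close>

lemma A2_deriv_evaluation:
  assumes f: "f \<in> A2" and w: "cmod w < 1"
  shows "cmod ((deriv ^^ k) f w) \<le> deriv_const k * A2_norm f / (1 - cmod w) ^ Suc k"
proof -
  define d where "d = 1 - cmod w"
  have d: "d > 0" using w by (simp add: d_def)
  have small: "cmod x \<le> 1 - d / 2" if "dist w x \<le> d / 2" for x
    using that norm_triangle_ineq2[of x w] by (simp add: dist_norm norm_minus_commute d_def field_simps)
  have h: "f holomorphic_on cball w (d/2)"
    using small d by (intro holomorphic_on_subset[OF A2_holomorphic[OF f]]) force
  have "norm ((deriv ^^ k) f w) \<le> fact k * (64 * A2_norm f / d) / (d / 2) ^ k"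
  proof (rule Cauchy_inequality)
    show "f holomorphic_on ball w (d/2)" using h by (rule holomorphic_on_subset) auto
    show "continuous_on (cball w (d/2)) f" using h by (rule holomorphic_on_imp_continuous_on)
    show "norm (f x) \<le> 64 * A2_norm f / d" if "norm (w - x) = d / 2" for x
    proof -
      have x: "d / 2 \<le> 1 - cmod x" using small[of x] that by (simp add: dist_norm)
      then have "cmod (f x) * (d / 2) \<le> cmod (f x) * (1 - cmod x)"
        by (intro mult_left_mono) auto
      also have "\<dots> \<le> 32 * A2_norm f"
        using x d by (intro A2_point_evaluation f) auto
      finally show ?thesis using d by (simp add: field_simps)
    qed
  qed (use d in auto)
  also have "\<dots> = deriv_const k * A2_norm f / d ^ Suc k"
    using d by (simp add: deriv_const_def field_simps)
  finally show ?thesis by (simp add: d_def)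
qed

section \<open>Completeness and Parseval's identity\<close>

text \<open>Point evaluation makes a norm-Cauchy sequence uniformly Cauchy on each smaller closed
  disc, so the pointwise limit is holomorphic. Fatou's lemma carries the rate \<open>\<tau>\<close>
  over to the limit unchanged.\<close>

lemma A2_complete:
  assumes s: "\<And>n. s n \<in> A2" and \<tau>: "\<tau> \<longlonglongrightarrow> (0::real)"
    and Cauchy: "\<And>M N. N \<le> M \<Longrightarrow> (A2_norm (\<lambda>z. s M z - s N z))\<^sup>2 \<le> \<tau> N"
  obtains g where "g \<in> A2" "\<And>N. (A2_norm (\<lambda>z. g z - s N z))\<^sup>2 \<le> \<tau> N"
proof -
  define g where "g = (\<lambda>z. lim (\<lambda>n. s n z))"
  have \<tau>_nonneg: "\<tau> N \<ge> 0" for N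
    using Cauchy[of N N] zero_le_power2[of "A2_norm (\<lambda>z. s N z - s N z)"] by linarith
  have ptw: "dist (s M z) (s N z) \<le> 32 * sqrt (\<tau> N) / (1 - r)"
    if "N \<le> M" "r < 1" "z \<in> cball 0 r" for M N r z
  proof -
    have z: "cmod z \<le> r" using that by simp
    have "cmod (s M z - s N z) * (1 - r) \<le> cmod (s M z - s N z) * (1 - cmod z)"
      using z by (intro mult_left_mono) auto
    also have "\<dots> \<le> 32 * A2_norm (\<lambda>z. s M z - s N z)"
      using z that by (intro A2_point_evaluation A2_diff s) auto
    also have "\<dots> \<le> 32 * sqrt (\<tau> N)"
      using Cauchy[OF that(1)] by (simp add: real_le_rsqrt)
    finally show ?thesis using that by (simp add: dist_norm field_simps)
  qed
  have ulim: "uniform_limit (cball 0 r) s g sequentially" if "r < 1" for r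
  proof -
    have "(\<lambda>N. 32 * sqrt (\<tau> N) / (1 - r)) \<longlonglongrightarrow> 32 * sqrt 0 / (1 - r)"
      using that by (intro tendsto_intros \<tau>) auto
    then have lim0: "(\<lambda>N. 32 * sqrt (\<tau> N) / (1 - r)) \<longlonglongrightarrow> 0" by simp
    have "uniformly_Cauchy_on (cball 0 r) s"
    proof (rule uniformly_Cauchy_onI')
      fix \<epsilon> :: real assume "\<epsilon> > 0"
      then have "\<forall>\<^sub>F N in sequentially. 32 * sqrt (\<tau> N) / (1 - r) < \<epsilon>"
        using lim0 by (simp add: order_tendstoD(2))
      then obtain N0 where N0: "\<And>N. N \<ge> N0 \<Longrightarrow> 32 * sqrt (\<tau> N) / (1 - r) < \<epsilon>"
        by (auto simp: eventually_sequentially)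
      show "\<exists>M. \<forall>x\<in>cball 0 r. \<forall>m\<ge>M. \<forall>n>m. dist (s m x) (s n x) < \<epsilon>"
      proof (intro exI ballI allI impI)
        fix x :: complex and m n :: nat assume "x \<in> cball 0 r" "m \<ge> N0" "n > m"
        then show "dist (s m x) (s n x) < \<epsilon>"
          using ptw[of m n r x] N0[of m] that by (simp add: dist_commute)
      qed
    qed
    then show ?thesis
      using Cauchy_uniformly_convergent uniformly_convergent_uniform_limit_iff g_def by blast
  qed
  \<comment> \<open>Around each point of the disc there is a closed ball inside a centred closed
    disc of radius below 1, where the convergence is uniform.\<close>
  have ball_sub: "cball x ((1 - cmod x) / 2) \<subseteq> cball 0 ((1 + cmod x) / 2)" for x :: complex
  proof
    fix y assume "y \<in> cball x ((1 - cmod x) / 2)"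
    then show "y \<in> cball 0 ((1 + cmod x) / 2)"
      using norm_triangle_ineq2[of y x] by (simp add: dist_norm norm_minus_commute field_simps)
  qed
  have g_hol: "g holomorphic_on ball 0 1"
  proof (rule holomorphic_uniform_sequence)
    show "s n holomorphic_on ball 0 1" for n using s by (rule A2_holomorphic)
    fix x :: complex assume x: "x \<in> ball 0 1"
    let ?d = "(1 - cmod x) / 2"
    have "uniform_limit (cball x ?d) s g sequentially"
      using ulim[of "(1 + cmod x) / 2"] ball_sub x by (auto intro: uniform_limit_on_subset)
    moreover have "cball x ?d \<subseteq> ball 0 1"
      using ball_sub[of x] x by auto
    ultimately show "\<exists>d>0. cball x d \<subseteq> ball 0 1 \<and> uniform_limit (cball x d) s g sequentially"
      using x by (intro exI[of _ ?d]) auto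
  qed auto
  have lim: "(\<lambda>n. s n z) \<longlonglongrightarrow> g z" if "cmod z < 1" for z
    using tendsto_uniform_limitI[OF ulim[of "cmod z"], of z] that by simp
  have diff: "(\<lambda>z. g z - s N z) \<in> A2 \<and> (A2_norm (\<lambda>z. g z - s N z))\<^sup>2 \<le> \<tau> N" for N
  proof -
    have "(\<integral>\<^sup>+z. ennreal ((cmod (g z - s N z))\<^sup>2) \<partial>disc_measure)
        = (\<integral>\<^sup>+z. liminf (\<lambda>M. ennreal ((cmod (s M z - s N z))\<^sup>2)) \<partial>disc_measure)"
    proof (rule nn_integral_cong)
      fix z assume "z \<in> space disc_measure"
      then have "(\<lambda>M. ennreal ((cmod (s M z - s N z))\<^sup>2)) \<longlonglongrightarrow> ennreal ((cmod (g z - s N z))\<^sup>2)"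
        by (intro tendsto_intros lim) (simp add: space_restrict_space)
      then show "ennreal ((cmod (g z - s N z))\<^sup>2) = liminf (\<lambda>M. ennreal ((cmod (s M z - s N z))\<^sup>2))"
        using lim_imp_Liminf[OF sequentially_bot] by metis
    qed
    \<comment> \<open>Fatou's lemma, with \<open>N\<close> fixed and \<open>M\<close> tending to
      infinity.\<close>
    also have "\<dots> \<le> liminf (\<lambda>M. \<integral>\<^sup>+z. ennreal ((cmod (s M z - s N z))\<^sup>2) \<partial>disc_measure)"
    proof (rule nn_integral_liminf)
      show "(\<lambda>z. ennreal ((cmod (s M z - s N z))\<^sup>2)) \<in> borel_measurable disc_measure" for M
        using A2_measurable[OF A2_diff[OF s s, of M N]] by measurable
    qed
    also have "\<dots> \<le> liminf (\<lambda>M. ennreal (pi * \<tau> N))"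
    proof (rule Liminf_mono)
      show "\<forall>\<^sub>F M in sequentially. (\<integral>\<^sup>+z. ennreal ((cmod (s M z - s N z))\<^sup>2) \<partial>disc_measure) \<le> ennreal (pi * \<tau> N)"
        using eventually_ge_at_top[of N]
        by eventually_elim (auto simp: A2_norm_sq_nn_integral A2_diff s intro!: ennreal_leI mult_left_mono Cauchy)
    qed
    also have "\<dots> = ennreal (pi * \<tau> N)" by (simp add: Liminf_const)
    finally have le: "(\<integral>\<^sup>+z. ennreal ((cmod (g z - s N z))\<^sup>2) \<partial>disc_measure) \<le> ennreal (pi * \<tau> N)" .
    have hol: "(\<lambda>z. g z - s N z) holomorphic_on ball 0 1"
      by (intro holomorphic_intros g_hol A2_holomorphic s)
    show ?thesis using A2_memI_nn_integral[OF hol le \<tau>_nonneg] by blast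
  qed
  \<comment> \<open>So far only the differences \<open>g - s N\<close> are known to lie in
    \<open>A2\<close>.\<close>
  have "(\<lambda>z. (g z - s 0 z) + s 0 z) \<in> A2" using diff s by (intro A2_add) auto
  then have "g \<in> A2" by simp
  with diff that show ?thesis by blast
qed

lemma orthonormal_basis_imp_orthonormal: "A2_orthonormal_basis e \<Longrightarrow> A2_orthonormal e"
  by (simp add: A2_orthonormal_basis_def A2_orthonormal_def)

text \<open>By Bessel's inequality the partial sums are Cauchy, hence have a limit \<open>g\<close>
  in \<open>A2\<close>. The difference \<open>f - g\<close> is orthogonal to every
  \<open>e j\<close>, so completeness of the basis identifies \<open>g\<close> with \<open>f\<close>
  on the disc.\<close>

lemma A2_orthonormal_basis_expansion:
  assumes e: "A2_orthonormal_basis e" and f: "f \<in> A2"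
  shows "(\<lambda>N. A2_norm (\<lambda>z. f z - (\<Sum>j<N. A2_inner f (e j) * e j z))) \<longlonglongrightarrow> 0"
proof -
  have on: "A2_orthonormal e" using e by (rule orthonormal_basis_imp_orthonormal)
  have e_mem: "e j \<in> A2" for j using on by (simp add: A2_orthonormal_def)
  define c where "c j = A2_inner f (e j)" for j
  define s where "s N = (\<lambda>z. \<Sum>j<N. c j * e j z)" for N
  \<comment> \<open>The tail of the coefficient series, which dominates the squared distance between
    later partial sums.\<close>
  define \<tau> where "\<tau> N = (\<Sum>j. (cmod (c j))\<^sup>2) - (\<Sum>j<N. (cmod (c j))\<^sup>2)" for N
  have summ: "summable (\<lambda>j. (cmod (c j))\<^sup>2)"
    using A2_Bessel[OF on _ f] by (intro bounded_imp_summable[where B="(A2_norm f)\<^sup>2"]) (auto simp: c_def)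
  have s_mem: "s N \<in> A2" for N unfolding s_def using on by (rule A2_lincomb_mem)
  have \<tau>: "\<tau> \<longlonglongrightarrow> 0"
  proof -
    have "\<tau> \<longlonglongrightarrow> (\<Sum>j. (cmod (c j))\<^sup>2) - (\<Sum>j. (cmod (c j))\<^sup>2)"
      unfolding \<tau>_def by (intro tendsto_intros summable_LIMSEQ summ)
    then show ?thesis by simp
  qed
  have "(A2_norm (\<lambda>z. s M z - s N z))\<^sup>2 \<le> \<tau> N" if "N \<le> M" for M N
  proof -
    have split: "{..<M} = {..<N} \<union> {N..<M}" "{..<N} \<inter> {N..<M} = {}" using that by auto
    have "(\<lambda>z. s M z - s N z) = (\<lambda>z. \<Sum>j\<in>{N..<M}. c j * e j z)"
      unfolding s_def split(1) by (subst sum.union_disjoint) auto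
    then have "(A2_norm (\<lambda>z. s M z - s N z))\<^sup>2 = (\<Sum>j\<in>{N..<M}. (cmod (c j))\<^sup>2)"
      using on by (simp add: A2_norm_lincomb)
    also have "\<dots> = (\<Sum>j<M. (cmod (c j))\<^sup>2) - (\<Sum>j<N. (cmod (c j))\<^sup>2)"
      unfolding split(1) by (subst sum.union_disjoint) auto
    also have "\<dots> \<le> \<tau> N"
      unfolding \<tau>_def using sum_le_suminf[OF summ, of "{..<M}"] by auto
    finally show ?thesis .
  qed
  then obtain g where g: "g \<in> A2" and gs: "\<And>N. (A2_norm (\<lambda>z. g z - s N z))\<^sup>2 \<le> \<tau> N"
    using A2_complete[of s \<tau>] s_mem \<tau> by metis
  have gs_lim: "(\<lambda>N. A2_norm (\<lambda>z. g z - s N z)) \<longlonglongrightarrow> 0"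
  proof (rule tendsto_sandwich[of "\<lambda>_. 0" _ _ "\<lambda>N. sqrt (\<tau> N)"])
    show "(\<lambda>N. sqrt (\<tau> N)) \<longlonglongrightarrow> 0" using tendsto_real_sqrt[OF \<tau>] by simp
    show "\<forall>\<^sub>F N in sequentially. A2_norm (\<lambda>z. g z - s N z) \<le> sqrt (\<tau> N)"
      using gs by (simp add: real_le_rsqrt)
  qed auto
  have fg: "(\<lambda>z. f z - g z) \<in> A2" using f g by (rule A2_diff)
  have "A2_inner (\<lambda>z. f z - g z) (e j) = 0" for j
  proof -
    \<comment> \<open>Once \<open>N > j\<close>, the partial sum \<open>s N\<close> has the same
      \<open>j\<close>-th coefficient as \<open>f\<close>, so \<open>f\<close> may be replaced by
      \<open>s N\<close>, which tends to \<open>g\<close>.\<close>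
    have "cmod (A2_inner (\<lambda>z. f z - g z) (e j)) \<le> A2_norm (\<lambda>z. g z - s N z)" if "N > j" for N
    proof -
      have "A2_inner (\<lambda>z. f z - g z) (e j) = - A2_inner (\<lambda>z. g z - s N z) (e j)"
        using that f g s_mem[of N] e_mem[of j] A2_inner_lincomb[OF on, of "{..<N}" c j]
        by (simp add: A2_inner_diff_left c_def s_def)
      then show ?thesis using A2_inner_le_norm[OF on A2_diff[OF g s_mem[of N]], of j] by simp
    qed
    then have "\<forall>\<^sub>F N in sequentially. cmod (A2_inner (\<lambda>z. f z - g z) (e j)) \<le> A2_norm (\<lambda>z. g z - s N z)"
      by (intro eventually_mono[OF eventually_gt_at_top[of j]])
    then have "cmod (A2_inner (\<lambda>z. f z - g z) (e j)) \<le> 0"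
      using gs_lim by (intro tendsto_lowerbound[OF gs_lim]) auto
    then show ?thesis by simp
  qed
  then have "A2_norm (\<lambda>z. f z - g z) = 0"
    using e fg by (simp add: A2_orthonormal_basis_def)
  then have eq: "f z = g z" if "cmod z < 1" for z
    using A2_norm_zero_imp[OF fg] that by simp
  have "A2_norm (\<lambda>z. f z - s N z) = A2_norm (\<lambda>z. g z - s N z)" for N
    by (rule A2_norm_cong) (simp add: eq)
  then show ?thesis using gs_lim by (simp add: s_def c_def)
qed

section \<open>Test functions\<close>

lemma inverse_fourth_power_le_dyadic_sum:
  assumes "d > 0" "d \<le> dist a z"
  shows "ennreal (1 / dist a z ^ 4)
     \<le> (\<Sum>m. ennreal (1 / (2 ^ m * d) ^ 4) * indicator (ball a (2 ^ Suc m * d)) z)"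
proof -
  let ?P = "\<lambda>m. dist a z < 2 ^ Suc m * d"
  let ?t = "\<lambda>m. ennreal (1 / (2 ^ m * d) ^ 4) * indicator (ball a (2 ^ Suc m * d)) z"
  have "\<exists>m. ?P m"
  proof -
    obtain m where "dist a z / d < 2 ^ m" using real_arch_pow[of 2 "dist a z / d"] by auto
    then have "dist a z < 2 ^ m * d" using assms by (simp add: field_simps)
    also have "\<dots> \<le> 2 ^ Suc m * d" using assms by simp
    finally show ?thesis by blast
  qed
  \<comment> \<open>The index of the dyadic annulus around \<open>a\<close> that contains
    \<open>z\<close>. For \<open>m = 0\<close> its inner bound is the assumption on
    \<open>d\<close>; otherwise it comes from minimality. The term of this index alone dominates the
    left side.\<close>
  define m where "m = (LEAST m. ?P m)"
  have upper: "?P m" unfolding m_def by (rule LeastI_ex) fact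
  have lower: "2 ^ m * d \<le> dist a z"
  proof (cases m)
    case 0
    then show ?thesis using assms by simp
  next
    case (Suc n)
    then have "\<not> ?P n" using not_less_Least[of n ?P] by (simp add: m_def)
    then show ?thesis using Suc by simp
  qed
  have "1 / dist a z ^ 4 \<le> 1 / (2 ^ m * d) ^ 4"
    using lower assms by (intro divide_left_mono power_mono mult_pos_pos) (auto intro!: zero_less_power)
  then have "ennreal (1 / dist a z ^ 4) \<le> ?t m"
    using upper by (simp add: ennreal_leI)
  also have "\<dots> \<le> (\<Sum>m. ?t m)"
  proof -
    have "sum ?t {m} \<le> suminf ?t" by (rule sum_le_suminf) auto
    then show ?thesis by (simp only: sum.insert_remove finite.emptyI Diff_empty sum.empty empty_Diff add_0_right)
  qed
  finally show ?thesis .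
qed

text \<open>In the dyadic sum the \<open>m\<close>-th ball has area
  \<open>pi * (2 ^ Suc m * d)\<^sup>2\<close> and weight \<open>1 / (2 ^ m * d) ^ 4\<close>. The
  products form a geometric series of ratio \<open>1/4\<close> with sum
  \<open>16 * pi / (3 * d\<^sup>2)\<close>.\<close>

lemma nn_integral_inverse_fourth_power_le:
  fixes a :: complex
  assumes d: "d > 0" and far: "\<And>z. cmod z < 1 \<Longrightarrow> d \<le> dist a z"
  shows "(\<integral>\<^sup>+z. ennreal (1 / dist a z ^ 4) \<partial>disc_measure) \<le> ennreal (16 * pi / d\<^sup>2)"
proof -
  let ?t = "\<lambda>m z. ennreal (1 / (2 ^ m * d) ^ 4) * indicator (ball a (2 ^ Suc m * d)) z"
  have "(\<integral>\<^sup>+z. ennreal (1 / dist a z ^ 4) \<partial>disc_measure)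
      = (\<integral>\<^sup>+z. ennreal (1 / dist a z ^ 4) * indicator (ball 0 1) z \<partial>lborel)"
    by (subst nn_integral_restrict_space) auto
  also have "\<dots> \<le> (\<integral>\<^sup>+z. (\<Sum>m. ?t m z) \<partial>lborel)"
    using d far by (intro nn_integral_mono)
      (auto simp: indicator_def[of "ball 0 1"] simp del: power_Suc
        intro!: inverse_fourth_power_le_dyadic_sum)
  also have "\<dots> = (\<Sum>m. \<integral>\<^sup>+z. ?t m z \<partial>lborel)"
    by (intro nn_integral_suminf borel_measurable_times_ennreal borel_measurable_indicator) auto
  also have "\<dots> = (\<Sum>m. ennreal ((4 * pi / d\<^sup>2) * (1/4) ^ m))"
  proof (rule suminf_cong)
    fix m
    have "(\<integral>\<^sup>+z. ?t m z \<partial>lborel)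
        = ennreal (1 / (2 ^ m * d) ^ 4) * emeasure lborel (ball a (2 ^ Suc m * d))"
      by (subst nn_integral_cmult_indicator) auto
    also have "emeasure lborel (ball a (2 ^ Suc m * d)) = ennreal (pi * (2 ^ Suc m * d)\<^sup>2)"
      using d emeasure_ball[of "2 ^ Suc m * d" a] by (simp add: unit_ball_vol_2)
    also have "ennreal (1 / (2 ^ m * d) ^ 4) * \<dots>
        = ennreal (1 / (2 ^ m * d) ^ 4 * (pi * (2 ^ Suc m * d)\<^sup>2))"
      using d by (intro ennreal_mult[symmetric]) auto
    also have "1 / (2 ^ m * d) ^ 4 * (pi * (2 ^ Suc m * d)\<^sup>2) = (4 * pi / d\<^sup>2) * (1/4) ^ m"
    proof -
      have "(4::real) ^ m = 2 ^ m * 2 ^ m" using power_mult_distrib[of "2::real" 2 m] by simp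
      then show ?thesis using d
        by (simp add: field_simps power2_eq_square power4_eq_xxxx)
    qed
    finally show "(\<integral>\<^sup>+z. ?t m z \<partial>lborel) = ennreal ((4 * pi / d\<^sup>2) * (1/4) ^ m)" .
  qed
  also have "\<dots> = ennreal (\<Sum>m. (4 * pi / d\<^sup>2) * (1/4) ^ m)"
    using d by (intro suminf_ennreal2) (auto intro!: summable_mult summable_geometric)
  also have "(\<Sum>m. (4 * pi / d\<^sup>2) * (1/4::real) ^ m) = 16 * pi / (3 * d\<^sup>2)"
    by (subst suminf_mult) (auto intro!: summable_geometric simp: suminf_geometric)
  also have "ennreal \<dots> \<le> ennreal (16 * pi / d\<^sup>2)"
    using d by (intro ennreal_leI) (auto simp: field_simps)
  finally show ?thesis .
qed

lemma cmod_one_minus_cnj_ge: "cmod z \<le> 1 \<Longrightarrow> 1 - cmod w \<le> cmod (1 - cnj w * z)"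
  using norm_triangle_ineq2[of 1 "cnj w * z"] mult_left_le[of "cmod z" "cmod w"]
  by (simp add: norm_mult)

text \<open>The Moebius quotient of \<open>z - w\<close> by \<open>1 - cnj w * z\<close> has modulus
  at most 1 where it is defined; the difference of squares factors as in the first step.\<close>

lemma cmod_diff_le_one_minus_cnj:
  assumes "cmod w \<le> 1" "cmod z \<le> 1"
  shows "cmod (z - w) \<le> cmod (1 - cnj w * z)"
proof -
  have "(cmod (1 - cnj w * z))\<^sup>2 - (cmod (z - w))\<^sup>2 = (1 - (cmod w)\<^sup>2) * (1 - (cmod z)\<^sup>2)"
    unfolding cmod_power2 by (simp add: power2_eq_square algebra_simps)
  also have "\<dots> \<ge> 0"
    using assms by (intro mult_nonneg_nonneg) (auto simp: abs_square_le_1)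
  finally have "(cmod (z - w))\<^sup>2 \<le> (cmod (1 - cnj w * z))\<^sup>2" by simp
  then show ?thesis by (rule power2_le_imp_le) simp
qed

lemma nn_integral_kernel_le:
  assumes w: "cmod w < 1"
  shows "(\<integral>\<^sup>+z. ennreal (1 / cmod (1 - cnj w * z) ^ 4) \<partial>disc_measure)
      \<le> ennreal (64 * pi / (1 - cmod w)\<^sup>2)"
\<comment> \<open>For small \<open>w\<close> the integrand is at most 16. For larger
  \<open>w\<close> it is a multiple of an inverse fourth power of the distance to the reflected
  point \<open>1 / cnj w\<close>, which lies at distance at least
  \<open>(1 - cmod w) / cmod w\<close> from the disc.\<close>
proof (cases "cmod w \<le> 1 / 2")
  case True
  have "(\<integral>\<^sup>+z. ennreal (1 / cmod (1 - cnj w * z) ^ 4) \<partial>disc_measure)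
      \<le> (\<integral>\<^sup>+z. ennreal 16 \<partial>disc_measure)"
  proof (intro nn_integral_mono ennreal_leI)
    fix z assume "z \<in> space disc_measure"
    then have "1 / 2 \<le> cmod (1 - cnj w * z)"
      using cmod_one_minus_cnj_ge[of z w] True by (simp add: space_restrict_space)
    then have "(1 / 2) ^ 4 \<le> cmod (1 - cnj w * z) ^ 4" by (intro power_mono) auto
    then show "1 / cmod (1 - cnj w * z) ^ 4 \<le> 16"
      by (subst pos_divide_le_eq) (auto simp: power_one_over intro: less_le_trans[of 0 "(1/2)^4"])
  qed
  also have "\<dots> = ennreal 16 * ennreal pi"
    using emeasure_ball[of 1 "0::complex"]
    by (simp add: space_restrict_space emeasure_restrict_space unit_ball_vol_2)
  also have "\<dots> = ennreal (16 * pi)" by (simp add: ennreal_mult)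
  also have "\<dots> \<le> ennreal (64 * pi / (1 - cmod w)\<^sup>2)"
  proof (rule ennreal_leI)
    have "16 * pi * (1 - cmod w)\<^sup>2 \<le> 16 * pi * 1"
      using w by (intro mult_left_mono) (auto simp: abs_square_le_1)
    then show "16 * pi \<le> 64 * pi / (1 - cmod w)\<^sup>2"
      using w pi_gt_zero by (subst pos_le_divide_eq) auto
  qed
  finally show ?thesis .
next
  case False
  define a where "a = 1 / cnj w"
  define d where "d = (1 - cmod w) / cmod w"
  have w0: "w \<noteq> 0" using False by auto
  have d: "d > 0" using w w0 by (simp add: d_def)
  have dist: "cmod (1 - cnj w * z) = cmod w * dist a z" for z
  proof -
    have "1 - cnj w * z = cnj w * (a - z)" using w0 by (simp add: a_def field_simps)
    then show ?thesis by (simp only: norm_mult dist_norm complex_mod_cnj)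
  qed
  have far: "d \<le> dist a z" if "cmod z < 1" for z
    using cmod_one_minus_cnj_ge[of z w] that w0 dist[of z] by (simp add: d_def field_simps)
  have "(\<integral>\<^sup>+z. ennreal (1 / cmod (1 - cnj w * z) ^ 4) \<partial>disc_measure)
     = (\<integral>\<^sup>+z. ennreal (1 / cmod w ^ 4) * ennreal (1 / dist a z ^ 4) \<partial>disc_measure)"
    by (simp add: dist power_mult_distrib flip: ennreal_mult)
  also have "\<dots> = ennreal (1 / cmod w ^ 4) * (\<integral>\<^sup>+z. ennreal (1 / dist a z ^ 4) \<partial>disc_measure)"
    by (intro nn_integral_cmult measurable_restrict_space1) measurable
  also have "\<dots> \<le> ennreal (1 / cmod w ^ 4) * ennreal (16 * pi / d\<^sup>2)"
    using nn_integral_inverse_fourth_power_le[OF d far] by (intro mult_left_mono) auto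
  also have "\<dots> = ennreal (1 / cmod w ^ 4 * (16 * pi / d\<^sup>2))"
    by (rule ennreal_mult[symmetric]) auto
  also have "\<dots> \<le> ennreal (64 * pi / (1 - cmod w)\<^sup>2)"
  proof (rule ennreal_leI)
    have "(1/2)\<^sup>2 \<le> (cmod w)\<^sup>2" using False by (intro power_mono) auto
    then have "16 * pi / (cmod w)\<^sup>2 \<le> 64 * pi"
      using w0 by (simp add: field_simps)
    then have "16 * pi / (cmod w)\<^sup>2 / (1 - cmod w)\<^sup>2 \<le> 64 * pi / (1 - cmod w)\<^sup>2"
      by (rule divide_right_mono) simp
    then show "1 / cmod w ^ 4 * (16 * pi / d\<^sup>2) \<le> 64 * pi / (1 - cmod w)\<^sup>2"
      using w0 by (simp add: d_def power_divide field_simps power2_eq_square power4_eq_xxxx)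
  qed
  finally show ?thesis .
qed

text \<open>The \<open>k\<close>-th power of the Moebius factor with zero \<open>w\<close>, times
  the Bergman kernel at \<open>w\<close> scaled by \<open>1 - cmod w\<close>. The Moebius factor
  creates a zero of order \<open>k\<close> at \<open>w\<close>, and the scaling keeps the norms
  bounded uniformly in \<open>w\<close> and \<open>k\<close>.\<close>

definition test_fun :: "nat \<Rightarrow> complex \<Rightarrow> complex \<Rightarrow> complex" where
  "test_fun k w z = (z - w) ^ k * (of_real (1 - cmod w) / (1 - cnj w * z) ^ (k + 2))"

section \<open>Norms and derivatives of the test functions\<close>

lemma cnj_mult_neq_one: "cmod w < 1 \<Longrightarrow> cmod z < 1 \<Longrightarrow> cnj w * z \<noteq> 1"
  using cmod_one_minus_cnj_ge[of z w] by auto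

lemma test_fun_A2:
  assumes w: "cmod w < 1"
  shows "test_fun k w \<in> A2" "A2_norm (test_fun k w) \<le> 8"
proof -
  have hol: "test_fun k w holomorphic_on ball 0 1"
    unfolding test_fun_def[abs_def] using w
    by (intro holomorphic_intros) (auto simp: cnj_mult_neq_one)
  have "(\<integral>\<^sup>+z. ennreal ((cmod (test_fun k w z))\<^sup>2) \<partial>disc_measure)
     \<le> (\<integral>\<^sup>+z. ennreal ((1 - cmod w)\<^sup>2) * ennreal (1 / cmod (1 - cnj w * z) ^ 4) \<partial>disc_measure)"
  proof (rule nn_integral_mono)
    fix z assume "z \<in> space disc_measure"
    then have z: "cmod z < 1" by (simp add: space_restrict_space)
    let ?q = "cmod (1 - cnj w * z)"
    have q: "?q > 0" using cnj_mult_neq_one[OF w z] by simp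
    \<comment> \<open>The Moebius factor is bounded by 1, which removes the dependence on
      \<open>k\<close> and leaves the kernel integral.\<close>
    have "cmod (z - w) ^ k \<le> ?q ^ k"
      using cmod_diff_le_one_minus_cnj[of w z] w z by (intro power_mono) auto
    then have "cmod (test_fun k w z) \<le> ?q ^ k * ((1 - cmod w) / ?q ^ (k + 2))"
      unfolding test_fun_def norm_mult norm_divide norm_power norm_of_real using w
      by (intro mult_mono divide_nonneg_nonneg) auto
    also have "\<dots> = (1 - cmod w) / ?q\<^sup>2" using q by (simp add: power_add power2_eq_square)
    finally have "(cmod (test_fun k w z))\<^sup>2 \<le> ((1 - cmod w) / ?q\<^sup>2)\<^sup>2"
      by (intro power_mono) auto
    also have "\<dots> = (1 - cmod w)\<^sup>2 * (1 / ?q ^ 4)"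
      by (simp add: power_divide flip: power_mult)
    finally show "ennreal ((cmod (test_fun k w z))\<^sup>2) \<le> ennreal ((1 - cmod w)\<^sup>2) * ennreal (1 / ?q ^ 4)"
      by (simp add: ennreal_leI flip: ennreal_mult)
  qed
  also have "\<dots> = ennreal ((1 - cmod w)\<^sup>2) * (\<integral>\<^sup>+z. ennreal (1 / cmod (1 - cnj w * z) ^ 4) \<partial>disc_measure)"
    by (intro nn_integral_cmult measurable_restrict_space1) measurable
  also have "\<dots> \<le> ennreal ((1 - cmod w)\<^sup>2) * ennreal (64 * pi / (1 - cmod w)\<^sup>2)"
    using nn_integral_kernel_le[OF w] by (intro mult_left_mono) auto
  also have "\<dots> = ennreal (pi * 64)"
    using w by (subst ennreal_mult[symmetric]) (auto simp: field_simps)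
  finally have le: "(\<integral>\<^sup>+z. ennreal ((cmod (test_fun k w z))\<^sup>2) \<partial>disc_measure) \<le> ennreal (pi * 64)" .
  show "test_fun k w \<in> A2" using A2_memI_nn_integral(1)[OF hol le] by simp
  have "(A2_norm (test_fun k w))\<^sup>2 \<le> 8\<^sup>2" using A2_memI_nn_integral(2)[OF hol le] by simp
  then show "A2_norm (test_fun k w) \<le> 8" by (rule power2_le_imp_le) simp
qed

text \<open>In the Leibniz rule at \<open>w\<close>, only the \<open>k\<close>-th derivative of
  \<open>(z - w) ^ k\<close> is nonzero. Since \<open>j \<le> k\<close>, this term occurs only for
  \<open>j = k\<close>, where the other factor is undifferentiated.\<close>

lemma higher_deriv_test_fun:
  assumes w: "cmod w < 1" and j: "j \<le> k"
  shows "(deriv ^^ j) (test_fun k w) w =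
    (if j = k then fact k * of_real (1 - cmod w) / (1 - cnj w * w) ^ (k + 2) else 0)"
proof -
  let ?g = "\<lambda>z. of_real (1 - cmod w) / (1 - cnj w * z) ^ (k + 2)"
  have "(deriv ^^ j) (test_fun k w) w
      = (\<Sum>i = 0..j. of_nat (j choose i) * (deriv ^^ i) (\<lambda>z. (z - w) ^ k) w * (deriv ^^ (j - i)) ?g w)"
    unfolding test_fun_def[abs_def] using w
    by (intro higher_deriv_mult[where S="ball 0 1"] holomorphic_intros) (auto simp: cnj_mult_neq_one)
  also have "\<dots> = (\<Sum>i = 0..j. if i = k then fact k * ?g w else 0)"
    using j by (intro sum.cong) (auto simp: higher_deriv_power pochhammer_fact)
  finally show ?thesis using j by (auto simp: sum.delta)
qed

lemma test_fun_leading_deriv: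
  assumes w: "cmod w < 1"
  shows "cmod ((deriv ^^ k) (test_fun k w) w) \<ge> 1 / (2 ^ (k + 2) * (1 - cmod w) ^ Suc k)"
proof -
  define d where "d = 1 - cmod w"
  have d: "d > 0" using w by (simp add: d_def)
  have "1 - cnj w * w = of_real (1 - (cmod w)\<^sup>2)"
    using complex_norm_square[of w] by (simp add: mult.commute)
  moreover have sq: "1 - (cmod w)\<^sup>2 = d * (1 + cmod w)"
    by (simp add: d_def power2_eq_square algebra_simps)
  ultimately have norm: "cmod (1 - cnj w * w) = d * (1 + cmod w)"
    using d by (simp only: norm_of_real) auto
  \<comment> \<open>The exact value is \<open>fact k * d / (d * (1 + cmod w)) ^ (k + 2)\<close> with
    \<open>d = 1 - cmod w\<close>; the bounds \<open>1 + cmod w \<le> 2\<close> and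
    \<open>fact k \<ge> 1\<close> reduce it to the stated form.\<close>
  have "1 / (2 ^ (k + 2) * d ^ Suc k) = d / (d * 2) ^ (k + 2)"
    using d by (simp add: field_simps power_mult_distrib)
  also have "\<dots> \<le> d / (d * (1 + cmod w)) ^ (k + 2)"
    using d w by (intro divide_left_mono power_mono mult_left_mono mult_pos_pos zero_less_power) (auto intro: add_pos_nonneg)
  also have "\<dots> \<le> fact k * (d / (d * (1 + cmod w)) ^ (k + 2))"
    using d mult_right_mono[of 1 "fact k" "d / (d * (1 + cmod w)) ^ (k + 2)"]
    by (auto simp: fact_ge_1)
  also have "\<dots> = cmod ((deriv ^^ k) (test_fun k w) w)"
    using w by (simp add: higher_deriv_test_fun norm_mult norm_divide norm_power norm d_def[symmetric] del: power_add)
       (simp add: d_def)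
  finally show ?thesis by (simp add: d_def)
qed

text \<open>Testing against \<open>test_fun k w\<close>, which kills all derivatives of order below \<open>k\<close> at \<open>w\<close>,
  gives a triangular system, which is solved from \<open>k = n\<close> downwards.\<close>
lemma functional_coeff_bound_aux:
  "\<exists>C>0. \<forall>w a M k. cmod w < 1 \<longrightarrow> (\<forall>f\<in>A2. cmod (\<Sum>j\<le>n. a j * (deriv ^^ j) f w) \<le> M * A2_norm f)
     \<longrightarrow> M \<ge> 0 \<longrightarrow> k \<le> n \<longrightarrow> n < k + m \<longrightarrow> cmod (a k) / (1 - cmod w) ^ Suc k \<le> C * M"
\<comment> \<open>Here \<open>m\<close> counts the coefficients already bounded, taken from the top
  index \<open>n\<close> downwards; for \<open>m = 0\<close> there are none.\<close>
proof (induction m)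
  case 0
  show ?case by (intro exI[of _ 1]) auto
next
  case (Suc m)
  then obtain C where C: "C > 0" and IH: "\<And>w a M k. cmod w < 1 \<Longrightarrow>
      (\<And>f. f \<in> A2 \<Longrightarrow> cmod (\<Sum>j\<le>n. a j * (deriv ^^ j) f w) \<le> M * A2_norm f)
     \<Longrightarrow> M \<ge> 0 \<Longrightarrow> k \<le> n \<Longrightarrow> n < k + m \<Longrightarrow> cmod (a k) / (1 - cmod w) ^ Suc k \<le> C * M"
    by meson
  \<comment> \<open>In the second summand, 8 is the norm bound of the test function, the sum bounds
    the terms with \<open>j > k\<close>, and \<open>2 ^ (n + 2)\<close> comes from dividing by the
    leading derivative.\<close>
  define C' where "C' = C + 2 ^ (n + 2) * (8 + (\<Sum>j\<le>n. C * (deriv_const j * 8)))"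
  have sum_nonneg: "(\<Sum>j\<le>n. C * (deriv_const j * 8)) \<ge> 0"
    using C deriv_const_pos by (intro sum_nonneg) (auto intro: less_imp_le)
  have "C' > 0"
    using C sum_nonneg unfolding C'_def by (intro add_pos_nonneg mult_nonneg_nonneg) auto
  moreover have "cmod (a k) / (1 - cmod w) ^ Suc k \<le> C' * M"
    if w: "cmod w < 1" and bd: "\<And>f. f \<in> A2 \<Longrightarrow> cmod (\<Sum>j\<le>n. a j * (deriv ^^ j) f w) \<le> M * A2_norm f"
      and M: "M \<ge> 0" and k: "k \<le> n" "n < k + Suc m" for w a M k
  proof (cases "n < k + m")
    case True
    then have "cmod (a k) / (1 - cmod w) ^ Suc k \<le> C * M"
      using IH[OF w bd M k(1)] by blast
    also have "\<dots> \<le> C' * M"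
      using M sum_nonneg by (intro mult_right_mono) (auto simp: C'_def)
    finally show ?thesis .
  next
    case False
    \<comment> \<open>Now \<open>n = k + m\<close>, so the induction hypothesis covers exactly the
      indices \<open>j\<close> with \<open>k < j \<le> n\<close>.\<close>
    define d where "d = 1 - cmod w"
    have d: "d > 0" using w by (simp add: d_def)
    let ?p = "test_fun k w"
    let ?D = "\<lambda>j. (deriv ^^ j) ?p w"
    have "{..n} = {..<k} \<union> {k<..n} \<union> {k}" using k by auto
    then have "(\<Sum>j\<le>n. a j * ?D j) = (\<Sum>j\<in>{k<..n}. a j * ?D j) + a k * ?D k"
    proof -
      assume eq: "{..n} = {..<k} \<union> {k<..n} \<union> {k}"
      have "(\<Sum>j<k. a j * ?D j) = 0"
        using w by (intro sum.neutral) (auto simp: higher_deriv_test_fun)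
      then show ?thesis
        unfolding eq by (subst sum.union_disjoint, simp, simp, force, subst sum.union_disjoint) auto
    qed
    then have "cmod (a k * ?D k) \<le> cmod (\<Sum>j\<le>n. a j * ?D j) + cmod (\<Sum>j\<in>{k<..n}. a j * ?D j)"
      using norm_triangle_ineq4[of "\<Sum>j\<le>n. a j * ?D j" "\<Sum>j\<in>{k<..n}. a j * ?D j"] by simp
    also have "\<dots> \<le> M * 8 + (\<Sum>j\<in>{k<..n}. C * M * (deriv_const j * 8))"
    proof (rule add_mono)
      have "cmod (\<Sum>j\<le>n. a j * ?D j) \<le> M * A2_norm ?p"
        using bd test_fun_A2 w by blast
      also have "\<dots> \<le> M * 8" using test_fun_A2[OF w] M by (intro mult_left_mono) auto
      finally show "cmod (\<Sum>j\<le>n. a j * ?D j) \<le> M * 8" .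
      have "cmod (a j * ?D j) \<le> C * M * (deriv_const j * 8)" if "j \<in> {k<..n}" for j
      proof -
        have "cmod (?D j) \<le> deriv_const j * A2_norm ?p / d ^ Suc j"
          unfolding d_def using test_fun_A2 w by (intro A2_deriv_evaluation) auto
        also have "\<dots> \<le> deriv_const j * 8 / d ^ Suc j"
          using test_fun_A2[OF w] d deriv_const_pos[of j]
          by (intro divide_right_mono mult_left_mono) auto
        finally have "cmod (a j * ?D j) \<le> cmod (a j) * (deriv_const j * 8 / d ^ Suc j)"
          unfolding norm_mult by (intro mult_left_mono) auto
        \<comment> \<open>The power of \<open>d\<close> lost in the derivative estimate is the one
          by which the induction hypothesis bounds \<open>a j\<close>, so the result is uniform in
          \<open>w\<close>.\<close>
        also have "\<dots> = cmod (a j) / d ^ Suc j * (deriv_const j * 8)" by simp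
        also have "\<dots> \<le> C * M * (deriv_const j * 8)"
          unfolding d_def using IH[OF w bd M, of j] that False k deriv_const_pos[of j]
          by (intro mult_right_mono) auto
        finally show ?thesis .
      qed
      then show "cmod (\<Sum>j\<in>{k<..n}. a j * ?D j) \<le> (\<Sum>j\<in>{k<..n}. C * M * (deriv_const j * 8))"
        by (rule sum_norm_le)
    qed
    also have "\<dots> \<le> M * 8 + (\<Sum>j\<le>n. C * M * (deriv_const j * 8))"
      using C M deriv_const_pos by (intro add_left_mono sum_mono2) (auto intro!: mult_nonneg_nonneg intro: less_imp_le)
    also have "\<dots> = (8 + (\<Sum>j\<le>n. C * (deriv_const j * 8))) * M"
      by (simp add: ring_distribs sum_distrib_left mult_ac)
    finally have le: "cmod (a k) * cmod (?D k) \<le> (8 + (\<Sum>j\<le>n. C * (deriv_const j * 8))) * M"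
      by (simp add: norm_mult)
    have "cmod (a k) * (1 / (2 ^ (k + 2) * d ^ Suc k)) \<le> cmod (a k) * cmod (?D k)"
      unfolding d_def by (intro mult_left_mono test_fun_leading_deriv w) auto
    with le have "cmod (a k) / d ^ Suc k / 2 ^ (k + 2) \<le> (8 + (\<Sum>j\<le>n. C * (deriv_const j * 8))) * M"
      by (simp add: mult.commute)
    then have "cmod (a k) / d ^ Suc k \<le> 2 ^ (k + 2) * ((8 + (\<Sum>j\<le>n. C * (deriv_const j * 8))) * M)"
      by (subst (asm) pos_divide_le_eq) (auto simp: mult.commute)
    also have "\<dots> \<le> 2 ^ (n + 2) * ((8 + (\<Sum>j\<le>n. C * (deriv_const j * 8))) * M)"
      using sum_nonneg M k by (intro mult_right_mono power_increasing) auto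
    also have "\<dots> \<le> C' * M"
      using C M by (simp add: C'_def algebra_simps)
    finally show ?thesis by (simp add: d_def)
  qed
  ultimately show ?case by blast
qed

text \<open>The case \<open>m = Suc n\<close>, where every \<open>k \<le> n\<close> is covered. The
  constant depends on \<open>n\<close> only, so it may be used at all points \<open>\<phi> z\<close>
  at once.\<close>

lemma functional_coeff_bound:
  obtains C where "C > 0"
    "\<And>w a M k. \<lbrakk>cmod w < 1; \<And>f. f \<in> A2 \<Longrightarrow> cmod (\<Sum>j\<le>n. a j * (deriv ^^ j) f w) \<le> M * A2_norm f;
      M \<ge> 0; k \<le> n\<rbrakk> \<Longrightarrow> cmod (a k) / (1 - cmod w) ^ Suc k \<le> C * M"
  using functional_coeff_bound_aux[of n "Suc n"] by (auto simp: less_Suc_eq_le)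

section \<open>The Hilbert--Schmidt criterion\<close>

text \<open>Up to constants depending on \<open>k\<close>, the norm on \<open>A2\<close> of the
  functional sending \<open>f\<close> to \<open>u k z * (deriv ^^ k) f (\<phi> z)\<close>.\<close>

definition weight :: "(nat \<Rightarrow> complex \<Rightarrow> complex) \<Rightarrow> (complex \<Rightarrow> complex) \<Rightarrow> nat \<Rightarrow> complex \<Rightarrow> real" where
  "weight u \<phi> k z = cmod (u k z) / (1 - cmod (\<phi> z)) ^ Suc k"

lemma L_op_eq: "L_op u \<phi> n f z = (\<Sum>k\<le>n. u k z * (deriv ^^ k) f (\<phi> z))"
  by (simp add: L_op_def W_op_def)

section \<open>Linearity and pointwise bounds of the operator\<close>

lemma higher_deriv_lincomb:
  assumes "\<And>j. j \<in> I \<Longrightarrow> f j holomorphic_on S" "open S" "w \<in> S"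
  shows "(deriv ^^ k) (\<lambda>z. \<Sum>j\<in>I. a j * f j z) w = (\<Sum>j\<in>I. a j * (deriv ^^ k) (f j) w)"
  using assms
proof (induction I rule: infinite_finite_induct)
  case (insert i I)
  then have "(deriv ^^ k) (\<lambda>z. a i * f i z + (\<Sum>j\<in>I. a j * f j z)) w
      = (deriv ^^ k) (\<lambda>z. a i * f i z) w + (deriv ^^ k) (\<lambda>z. \<Sum>j\<in>I. a j * f j z) w"
    by (intro higher_deriv_add[where S=S] holomorphic_intros) auto
  also have "(deriv ^^ k) (\<lambda>z. a i * f i z) w = a i * (deriv ^^ k) (f i) w"
    using insert by (intro higher_deriv_cmult[where A=S]) auto
  finally show ?case using insert by simp
qed auto

lemma L_op_lincomb:
  assumes "\<And>j. e j \<in> A2" "cmod (\<phi> z) < 1"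
  shows "L_op u \<phi> n (\<lambda>z. \<Sum>j\<in>I. a j * e j z) z = (\<Sum>j\<in>I. a j * L_op u \<phi> n (e j) z)"
proof -
  have "L_op u \<phi> n (\<lambda>z. \<Sum>j\<in>I. a j * e j z) z
      = (\<Sum>k\<le>n. u k z * (\<Sum>j\<in>I. a j * (deriv ^^ k) (e j) (\<phi> z)))"
    unfolding L_op_eq using assms
    by (subst higher_deriv_lincomb[where S="ball 0 1"]) (auto simp: A2_holomorphic)
  also have "\<dots> = (\<Sum>k\<le>n. \<Sum>j\<in>I. a j * (u k z * (deriv ^^ k) (e j) (\<phi> z)))"
    by (simp add: sum_distrib_left mult_ac)
  also have "\<dots> = (\<Sum>j\<in>I. a j * L_op u \<phi> n (e j) z)"
    unfolding L_op_eq sum_distrib_left by (rule sum.swap)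
  finally show ?thesis .
qed

lemma L_op_diff:
  assumes "f \<in> A2" "g \<in> A2" "cmod (\<phi> z) < 1"
  shows "L_op u \<phi> n (\<lambda>z. f z - g z) z = L_op u \<phi> n f z - L_op u \<phi> n g z"
  unfolding L_op_eq using assms
  by (subst higher_deriv_diff[where S="ball 0 1"])
     (auto simp: A2_holomorphic ring_distribs sum_subtractf)

text \<open>The derivative estimate is applied to each summand at \<open>\<phi> z\<close>;
  Cauchy-Schwarz over \<open>k\<close> then separates the constants from the weights.\<close>

lemma L_op_pointwise_bound:
  assumes f: "f \<in> A2" and z: "cmod (\<phi> z) < 1"
  shows "(cmod (L_op u \<phi> n f z))\<^sup>2
    \<le> (\<Sum>k\<le>n. (deriv_const k)\<^sup>2) * (\<Sum>k\<le>n. (weight u \<phi> k z)\<^sup>2) * (A2_norm f)\<^sup>2"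
proof -
  have "cmod (L_op u \<phi> n f z) \<le> (\<Sum>k\<le>n. deriv_const k * weight u \<phi> k z * A2_norm f)"
    unfolding L_op_eq
  proof (rule sum_norm_le)
    fix k
    have "cmod (u k z * (deriv ^^ k) f (\<phi> z))
        \<le> cmod (u k z) * (deriv_const k * A2_norm f / (1 - cmod (\<phi> z)) ^ Suc k)"
      unfolding norm_mult using f z by (intro mult_left_mono A2_deriv_evaluation) auto
    then show "cmod (u k z * (deriv ^^ k) f (\<phi> z)) \<le> deriv_const k * weight u \<phi> k z * A2_norm f"
      by (simp add: weight_def mult_ac)
  qed
  also have "\<dots> = (\<Sum>k\<le>n. deriv_const k * weight u \<phi> k z) * A2_norm f"
    by (rule sum_distrib_right[symmetric])
  finally have "(cmod (L_op u \<phi> n f z))\<^sup>2 \<le> ((\<Sum>k\<le>n. deriv_const k * weight u \<phi> k z) * A2_norm f)\<^sup>2"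
    by (intro power_mono) auto
  also have "\<dots> \<le> (\<Sum>k\<le>n. (deriv_const k)\<^sup>2) * (\<Sum>k\<le>n. (weight u \<phi> k z)\<^sup>2) * (A2_norm f)\<^sup>2"
    unfolding power_mult_distrib by (intro mult_right_mono Cauchy_Schwarz_ineq_sum) auto
  finally show ?thesis .
qed

text \<open>On partial sums of the expansion of \<open>f\<close> this is Cauchy-Schwarz together
  with Bessel's inequality. Evaluation of \<open>L_op\<close> at the fixed point \<open>z\<close> is
  continuous in the norm, so the bound passes to \<open>f\<close>.\<close>

lemma L_op_le_basis_sum:
  assumes e: "A2_orthonormal_basis e" and f: "f \<in> A2" and z: "cmod (\<phi> z) < 1"
    and summ: "summable (\<lambda>j. (cmod (L_op u \<phi> n (e j) z))\<^sup>2)"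
  shows "cmod (L_op u \<phi> n f z) \<le> sqrt (\<Sum>j. (cmod (L_op u \<phi> n (e j) z))\<^sup>2) * A2_norm f"
proof -
  have on: "A2_orthonormal e" using e by (rule orthonormal_basis_imp_orthonormal)
  have e_mem: "e j \<in> A2" for j using on by (simp add: A2_orthonormal_def)
  define S where "S = (\<Sum>j. (cmod (L_op u \<phi> n (e j) z))\<^sup>2)"
  define c where "c j = A2_inner f (e j)" for j
  define s where "s N = (\<lambda>z. \<Sum>j<N. c j * e j z)" for N
  define K where "K = (\<Sum>k\<le>n. (deriv_const k)\<^sup>2) * (\<Sum>k\<le>n. (weight u \<phi> k z)\<^sup>2)"
  have s_mem: "s N \<in> A2" for N unfolding s_def using on by (rule A2_lincomb_mem)
  have err: "(\<lambda>N. sqrt K * A2_norm (\<lambda>z. f z - s N z)) \<longlonglongrightarrow> sqrt K * 0"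
    unfolding s_def c_def by (intro tendsto_intros A2_orthonormal_basis_expansion e f)
  have le: "norm (L_op u \<phi> n f z - L_op u \<phi> n (s N) z) \<le> sqrt K * A2_norm (\<lambda>z. f z - s N z)" for N
  proof -
    have "(cmod (L_op u \<phi> n f z - L_op u \<phi> n (s N) z))\<^sup>2 \<le> K * (A2_norm (\<lambda>z. f z - s N z))\<^sup>2"
      unfolding K_def L_op_diff[of f "s N" \<phi> z, OF f s_mem z, symmetric]
      by (intro L_op_pointwise_bound A2_diff f s_mem z)
    then have "cmod (L_op u \<phi> n f z - L_op u \<phi> n (s N) z) \<le> sqrt (K * (A2_norm (\<lambda>z. f z - s N z))\<^sup>2)"
      by (rule real_le_rsqrt)
    then show ?thesis by (simp add: real_sqrt_mult)
  qed
  have "(\<lambda>N. L_op u \<phi> n f z - L_op u \<phi> n (s N) z) \<longlonglongrightarrow> 0"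
    by (rule Lim_null_comparison[OF always_eventually[OF allI[OF le]]]) (use err in simp)
  then have "(\<lambda>N. L_op u \<phi> n f z - (L_op u \<phi> n f z - L_op u \<phi> n (s N) z)) \<longlonglongrightarrow> L_op u \<phi> n f z - 0"
    by (rule tendsto_diff[OF tendsto_const])
  then have lim: "(\<lambda>N. cmod (L_op u \<phi> n (s N) z)) \<longlonglongrightarrow> cmod (L_op u \<phi> n f z)"
    by (simp add: tendsto_norm)
  have "cmod (L_op u \<phi> n (s N) z) \<le> sqrt S * A2_norm f" for N
  proof -
    have "cmod (L_op u \<phi> n (s N) z) \<le> (\<Sum>j<N. cmod (c j) * cmod (L_op u \<phi> n (e j) z))"
      unfolding s_def L_op_lincomb[of e \<phi> z, OF e_mem z] by (intro sum_norm_le) (simp add: norm_mult)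
    then have "(cmod (L_op u \<phi> n (s N) z))\<^sup>2 \<le> (\<Sum>j<N. cmod (c j) * cmod (L_op u \<phi> n (e j) z))\<^sup>2"
      by (intro power_mono) auto
    also have "\<dots> \<le> (\<Sum>j<N. (cmod (c j))\<^sup>2) * (\<Sum>j<N. (cmod (L_op u \<phi> n (e j) z))\<^sup>2)"
      by (rule Cauchy_Schwarz_ineq_sum)
    also have "\<dots> \<le> (A2_norm f)\<^sup>2 * S"
      unfolding S_def c_def using on f summ
      by (intro mult_mono A2_Bessel sum_le_suminf) (auto intro: sum_nonneg)
    finally have "cmod (L_op u \<phi> n (s N) z) \<le> sqrt ((A2_norm f)\<^sup>2 * S)"
      by (rule real_le_rsqrt)
    then show ?thesis by (simp add: real_sqrt_mult mult.commute)
  qed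
  then show ?thesis
    unfolding S_def[symmetric] by (intro tendsto_upperbound[OF lim]) auto
qed

section \<open>Equivalence with square integrability of the weights\<close>

context
  fixes n :: nat and u :: "nat \<Rightarrow> complex \<Rightarrow> complex" and \<phi> :: "complex \<Rightarrow> complex"
  assumes u_hol: "\<And>k. k \<le> n \<Longrightarrow> u k holomorphic_on ball 0 1"
    and \<phi>_hol: "\<phi> holomorphic_on ball 0 1" and \<phi>_ball: "\<phi> ` ball 0 1 \<subseteq> ball 0 1"
begin

lemma self_map_less_one: "cmod z < 1 \<Longrightarrow> cmod (\<phi> z) < 1"
  using \<phi>_ball by (force simp: image_subset_iff)

lemma L_op_holomorphic:
  assumes "f holomorphic_on ball 0 1"
  shows "L_op u \<phi> n f holomorphic_on ball 0 1"
proof -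
  have "(deriv ^^ k) f \<circ> \<phi> holomorphic_on ball 0 1" for k
    using assms by (intro holomorphic_on_compose_gen[OF \<phi>_hol _ \<phi>_ball] holomorphic_higher_deriv) auto
  then have "(\<lambda>z. (deriv ^^ k) f (\<phi> z)) holomorphic_on ball 0 1" for k
    by (simp add: o_def)
  then have "(\<lambda>z. \<Sum>k\<le>n. u k z * (deriv ^^ k) f (\<phi> z)) holomorphic_on ball 0 1"
    by (intro holomorphic_intros u_hol) auto
  then show ?thesis by (simp add: L_op_eq[abs_def])
qed

lemma weight_measurable:
  assumes "k \<le> n"
  shows "weight u \<phi> k \<in> borel_measurable disc_measure"
proof (rule continuous_on_disc_measurable)
  show "continuous_on (ball 0 1) (weight u \<phi> k)"
    unfolding weight_def[abs_def] using assms self_map_less_one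
    by (intro continuous_intros holomorphic_on_imp_continuous_on u_hol \<phi>_hol) force+
qed

text \<open>At each \<open>z\<close> the basis sum \<open>S z\<close> bounds the squared norm of the
  evaluation functional, and the coefficient bound extracts each weight from it. Integrating
  \<open>S\<close> term by term gives \<open>pi\<close> times the Hilbert-Schmidt sum.\<close>

lemma hilbert_schmidt_imp_weight_integrable:
  assumes hs: "hilbert_schmidt_A2 (L_op u \<phi> n)" and k: "k \<le> n"
  shows "integrable disc_measure (\<lambda>z. (weight u \<phi> k z)\<^sup>2)"
proof -
  obtain e where e: "A2_orthonormal_basis e" and summ: "summable (\<lambda>j. (A2_norm (L_op u \<phi> n (e j)))\<^sup>2)"
    and maps: "\<And>f. f \<in> A2 \<Longrightarrow> L_op u \<phi> n f \<in> A2"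
    using hs by (auto simp: hilbert_schmidt_A2_def)
  have mem: "L_op u \<phi> n (e j) \<in> A2" for j
    using maps e by (simp add: A2_orthonormal_basis_def)
  define S where "S z = (\<Sum>j. ennreal ((cmod (L_op u \<phi> n (e j) z))\<^sup>2))" for z
  obtain C where C: "C > 0" and coeff:
    "\<And>w a M k. \<lbrakk>cmod w < 1; \<And>f. f \<in> A2 \<Longrightarrow> cmod (\<Sum>j\<le>n. a j * (deriv ^^ j) f w) \<le> M * A2_norm f;
      M \<ge> 0; k \<le> n\<rbrakk> \<Longrightarrow> cmod (a k) / (1 - cmod w) ^ Suc k \<le> C * M"
    using functional_coeff_bound[of n] by blast
  have meas: "(\<lambda>z. ennreal ((cmod (L_op u \<phi> n (e j) z))\<^sup>2)) \<in> borel_measurable disc_measure" for j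
    using A2_measurable[OF mem[of j]] by measurable
  \<comment> \<open>With values in \<open>ennreal\<close> the estimate holds at every point; where
    \<open>S z\<close> is infinite it is trivial because \<open>C > 0\<close>.\<close>
  have ptw: "ennreal ((weight u \<phi> k z)\<^sup>2) \<le> ennreal (C\<^sup>2) * S z" if "cmod z < 1" for z
  proof (cases "S z = top")
    case True
    then show ?thesis using C by (simp add: ennreal_mult_top)
  next
    case False
    have z: "cmod (\<phi> z) < 1" using that by (rule self_map_less_one)
    have summ_z: "summable (\<lambda>j. (cmod (L_op u \<phi> n (e j) z))\<^sup>2)"
      using False by (intro summable_suminf_not_top) (auto simp: S_def)
    define R where "R = (\<Sum>j. (cmod (L_op u \<phi> n (e j) z))\<^sup>2)"
    have R: "R \<ge> 0" unfolding R_def using summ_z by (rule suminf_nonneg) simp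
    have SR: "S z = ennreal R"
      unfolding S_def R_def using summ_z by (intro suminf_ennreal2) auto
    have "cmod (u k z) / (1 - cmod (\<phi> z)) ^ Suc k \<le> C * sqrt R"
    proof (rule coeff[OF z _ _ k])
      show "cmod (\<Sum>j\<le>n. u j z * (deriv ^^ j) f (\<phi> z)) \<le> sqrt R * A2_norm f" if "f \<in> A2" for f
        using L_op_le_basis_sum[OF e that z summ_z] by (simp add: L_op_eq R_def)
    qed (use R in simp)
    then have "(weight u \<phi> k z)\<^sup>2 \<le> (C * sqrt R)\<^sup>2"
      unfolding weight_def using z by (intro power_mono) auto
    then show ?thesis
      using R by (simp add: SR power_mult_distrib ennreal_leI flip: ennreal_mult)
  qed
  have "(\<integral>\<^sup>+z. ennreal ((weight u \<phi> k z)\<^sup>2) \<partial>disc_measure)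
      \<le> (\<integral>\<^sup>+z. ennreal (C\<^sup>2) * S z \<partial>disc_measure)"
    by (intro nn_integral_mono ptw) (simp add: space_restrict_space)
  also have "\<dots> = ennreal (C\<^sup>2) * (\<Sum>j. \<integral>\<^sup>+z. ennreal ((cmod (L_op u \<phi> n (e j) z))\<^sup>2) \<partial>disc_measure)"
    unfolding S_def using meas by (simp add: nn_integral_cmult nn_integral_suminf)
  also have "\<dots> = ennreal (C\<^sup>2) * (\<Sum>j. ennreal (pi * (A2_norm (L_op u \<phi> n (e j)))\<^sup>2))"
    by (simp add: A2_norm_sq_nn_integral mem)
  also have "\<dots> = ennreal (C\<^sup>2) * ennreal (\<Sum>j. pi * (A2_norm (L_op u \<phi> n (e j)))\<^sup>2)"
    using summ by (subst suminf_ennreal2) (auto intro: summable_mult)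
  also have "\<dots> < \<infinity>" by (simp add: ennreal_mult_less_top)
  finally show ?thesis
    using weight_measurable[OF k] by (intro integrableI_bounded) auto
qed

text \<open>Testing a functional on \<open>\<Sum>j. cnj (\<ell> (e j)) * e j\<close> turns its norm bound into a bound for
  \<open>\<Sum>j. \<bar>\<ell> (e j)\<bar>\<^sup>2\<close>; this needs orthonormality only.\<close>
lemma L_op_basis_sum_le:
  assumes on: "A2_orthonormal e" and z: "cmod (\<phi> z) < 1" and I: "finite I"
  shows "(\<Sum>j\<in>I. (cmod (L_op u \<phi> n (e j) z))\<^sup>2)
    \<le> (\<Sum>k\<le>n. (deriv_const k)\<^sup>2) * (\<Sum>k\<le>n. (weight u \<phi> k z)\<^sup>2)" (is "?S \<le> ?K")
proof -
  have e_mem: "e j \<in> A2" for j using on by (simp add: A2_orthonormal_def)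
  let ?f = "\<lambda>x. \<Sum>j\<in>I. cnj (L_op u \<phi> n (e j) z) * e j x"
  have "L_op u \<phi> n ?f z = (\<Sum>j\<in>I. cnj (L_op u \<phi> n (e j) z) * L_op u \<phi> n (e j) z)"
    using e_mem z by (rule L_op_lincomb)
  also have "\<dots> = (\<Sum>j\<in>I. complex_of_real ((cmod (L_op u \<phi> n (e j) z))\<^sup>2))"
    by (intro sum.cong refl) (simp only: complex_norm_square mult.commute)
  also have "\<dots> = complex_of_real ?S" by simp
  finally have "?S\<^sup>2 = (cmod (L_op u \<phi> n ?f z))\<^sup>2"
    by (simp only: norm_of_real power2_abs)
  also have "\<dots> \<le> ?K * (A2_norm ?f)\<^sup>2"
    using z by (intro L_op_pointwise_bound A2_lincomb_mem on)
  also have "(A2_norm ?f)\<^sup>2 = ?S"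
    using on I by (simp add: A2_norm_lincomb)
  finally have le: "?S * ?S \<le> ?K * ?S" by (simp add: power2_eq_square)
  \<comment> \<open>The factor \<open>?S\<close> is cancelled when positive; for
    \<open>?S = 0\<close> the claim is \<open>?K \<ge> 0\<close>.\<close>
  have "?K \<ge> 0" by (intro mult_nonneg_nonneg sum_nonneg) auto
  moreover have "?S \<ge> 0" by (intro sum_nonneg) auto
  ultimately show ?thesis
    using le mult_le_cancel_right[of ?S ?S ?K] by linarith
qed

text \<open>The same integrable function \<open>B\<close> dominates both the pointwise values of
  \<open>L_op\<close> relative to the norm of \<open>f\<close> and the finite basis sums at each
  point. Its normalised integral \<open>J\<close> thus bounds the squared operator norm and the
  Hilbert-Schmidt sum.\<close>

lemma weight_integrable_imp_hilbert_schmidt: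
  assumes e: "A2_orthonormal_basis e"
    and int: "\<And>k. k \<le> n \<Longrightarrow> integrable disc_measure (\<lambda>z. (weight u \<phi> k z)\<^sup>2)"
  shows "hilbert_schmidt_A2 (L_op u \<phi> n)"
proof -
  have on: "A2_orthonormal e" using e by (rule orthonormal_basis_imp_orthonormal)
  have e_mem: "e j \<in> A2" for j using on by (simp add: A2_orthonormal_def)
  define B where "B z = (\<Sum>k\<le>n. (deriv_const k)\<^sup>2) * (\<Sum>k\<le>n. (weight u \<phi> k z)\<^sup>2)" for z
  define J where "J = (1 / pi) * (LINT z|disc_measure. B z)"
  have B: "integrable disc_measure B"
    unfolding B_def[abs_def] using int by auto
  have bound: "(cmod (L_op u \<phi> n f z))\<^sup>2 \<le> B z * (A2_norm f)\<^sup>2" if "f \<in> A2" "z \<in> ball 0 1" for f z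
    unfolding B_def using that by (intro L_op_pointwise_bound self_map_less_one) auto
  have maps: "L_op u \<phi> n f \<in> A2" if "f \<in> A2" for f
  proof (rule A2_memI_bound)
    show "L_op u \<phi> n f holomorphic_on ball 0 1"
      using that by (intro L_op_holomorphic A2_holomorphic)
    show "integrable disc_measure (\<lambda>z. B z * (A2_norm f)\<^sup>2)" using B by simp
  qed (rule bound[OF that])
  have norm_le: "A2_norm (L_op u \<phi> n f) \<le> sqrt J * A2_norm f" if "f \<in> A2" for f
  proof -
    have "(A2_norm (L_op u \<phi> n f))\<^sup>2 \<le> (1 / pi) * (LINT z|disc_measure. B z * (A2_norm f)\<^sup>2)"
      using maps[OF that] B bound[OF that] by (intro A2_norm_sq_le integrable_mult_left)
    then have "(A2_norm (L_op u \<phi> n f))\<^sup>2 \<le> J * (A2_norm f)\<^sup>2" by (simp add: J_def)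
    then have "A2_norm (L_op u \<phi> n f) \<le> sqrt (J * (A2_norm f)\<^sup>2)" by (rule real_le_rsqrt)
    then show ?thesis by (simp add: real_sqrt_mult)
  qed
  have "summable (\<lambda>j. (A2_norm (L_op u \<phi> n (e j)))\<^sup>2)"
  proof (rule bounded_imp_summable[where B=J])
    fix N
    have int_e: "integrable disc_measure (\<lambda>z. (cmod (L_op u \<phi> n (e j) z))\<^sup>2)" for j
      using maps[OF e_mem] by (rule A2_integrable)
    have "(\<Sum>j\<le>N. (A2_norm (L_op u \<phi> n (e j)))\<^sup>2)
        = (1 / pi) * (LINT z|disc_measure. (\<Sum>j\<le>N. (cmod (L_op u \<phi> n (e j) z))\<^sup>2))"
      unfolding A2_norm_sq using int_e by (simp add: sum_distrib_left)
    also have "\<dots> \<le> J"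
      unfolding J_def using B int_e
      by (intro mult_left_mono integral_mono)
         (auto simp: B_def space_restrict_space intro!: L_op_basis_sum_le on self_map_less_one)
    finally show "(\<Sum>j\<le>N. (A2_norm (L_op u \<phi> n (e j)))\<^sup>2) \<le> J" .
  qed auto
  with e maps norm_le show ?thesis unfolding hilbert_schmidt_A2_def by blast
qed

end

text \<open>A single weighted operator is a sum operator with all other coefficients zero, so both
  halves of the weight criterion apply to it.\<close>

lemma W_op_eq_L_op: "W_op (u k) \<phi> k = L_op (\<lambda>i. if i = k then u k else (\<lambda>z. 0)) \<phi> k"
proof (intro ext)
  fix f z
  have "(\<Sum>i\<le>k. W_op (if i = k then u k else (\<lambda>z. 0)) \<phi> i f z)
      = (\<Sum>i\<le>k. if i = k then W_op (u k) \<phi> k f z else 0)"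
    by (intro sum.cong) (auto simp: W_op_def)
  then show "W_op (u k) \<phi> k f z = L_op (\<lambda>i. if i = k then u k else (\<lambda>z. 0)) \<phi> k f z"
    by (simp add: L_op_def)
qed

theorem theorem1p9:
  fixes n :: nat and u :: "nat \<Rightarrow> complex \<Rightarrow> complex" and \<phi> :: "complex \<Rightarrow> complex"
  assumes "n \<ge> 1"
    and "\<And>k. k \<le> n \<Longrightarrow> u k holomorphic_on ball 0 1"
    and "\<phi> holomorphic_on ball 0 1" and "\<phi> ` ball 0 1 \<subseteq> ball 0 1"
  shows "hilbert_schmidt_A2 (L_op u \<phi> n) \<longleftrightarrow>
         (\<forall>k\<le>n. hilbert_schmidt_A2 (W_op (u k) \<phi> k))"
proof -
  note hyps = assms(2-4)
  define v where "v k = (\<lambda>i. if i = k then u k else (\<lambda>z. 0))" for k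
  have v_hol: "v k i holomorphic_on ball 0 1" if "k \<le> n" for k i
    using hyps(1)[OF that] by (auto simp: v_def)
  have W: "W_op (u k) \<phi> k = L_op (v k) \<phi> k" for k
    unfolding v_def by (rule W_op_eq_L_op)
  have weight_v: "weight (v k) \<phi> i = (if i = k then weight u \<phi> k else (\<lambda>z. 0))" for k i
    by (auto simp: v_def weight_def)
  show ?thesis
  proof (intro iffI allI impI)
    fix k assume L: "hilbert_schmidt_A2 (L_op u \<phi> n)" and k: "k \<le> n"
    \<comment> \<open>The converse half of the criterion takes an orthonormal basis as input; it is
      supplied by the Hilbert-Schmidt hypothesis.\<close>
    then obtain e where e: "A2_orthonormal_basis e" by (auto simp: hilbert_schmidt_A2_def)
    have "integrable disc_measure (\<lambda>z. (weight u \<phi> k z)\<^sup>2)"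
      using hyps L k by (rule hilbert_schmidt_imp_weight_integrable)
    then have "hilbert_schmidt_A2 (L_op (v k) \<phi> k)"
      by (intro weight_integrable_imp_hilbert_schmidt[OF v_hol[OF k] hyps(2,3) e]) (auto simp: weight_v)
    then show "hilbert_schmidt_A2 (W_op (u k) \<phi> k)" by (simp add: W)
  next
    assume Ws: "\<forall>k\<le>n. hilbert_schmidt_A2 (W_op (u k) \<phi> k)"
    then obtain e where e: "A2_orthonormal_basis e" by (auto simp: hilbert_schmidt_A2_def)
    have "integrable disc_measure (\<lambda>z. (weight u \<phi> k z)\<^sup>2)" if k: "k \<le> n" for k
    proof -
      have "hilbert_schmidt_A2 (L_op (v k) \<phi> k)" using Ws k by (simp add: W)
      from hilbert_schmidt_imp_weight_integrable[OF v_hol[OF k] hyps(2,3) this order_refl]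
      show ?thesis by (simp add: weight_v)
    qed
    then show "hilbert_schmidt_A2 (L_op u \<phi> n)"
      by (intro weight_integrable_imp_hilbert_schmidt[OF hyps e])
  qed
qed

end
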